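(* Let $\nu,d,p,q,R,M\in\mathbb{N}$. Let $\Sigma\in\mathcal{S}_{++}^d$ and $\Psi\in\mathcal{S}_{++}^\nu$ and let $\mathfrak{X}^{(1)},\mathfrak{X}^{(2)},\dots$ be iid with law $\mathcal{N}_{\nu\times d}(0_{\nu\times d},\Psi\otimes\Sigma)$. Suppose that $$\Sigma=\Sigma(\boldsymbol\beta^\star)=\sum_{j=1}^p\beta^\star_jB_j,\qquad \Psi=\Psi(\boldsymbol\alpha^\star)=\sum_{\ell=1}^q\alpha^\star_\ell A_\ell,$$ for some $\boldsymbol\beta^\star\in\mathbb{R}^p$, $\boldsymbol\alpha^\star\in\mathbb{R}^q$ and fixed symmetric matrices $\{B_j\}_{j=1}^p\subseteq\mathcal{S}^d$, $\{A_\ell\}_{\ell=1}^q\subseteq\mathcal{S}^\nu$, where $\Sigma(\boldsymbol\beta)=\sum_j\beta_jB_j$ and $\Psi(\boldsymbol\alpha)=\sum_\ell\alpha_\ell A_\ell$. Let $\{W_r\}_{r=1}^R\subseteq\mathcal{S}^\nu$ and $\{U_m\}_{m=1}^M\subseteq\mathcal{S}^d$ be given with $\mathrm{tr}(W_r)\ne0$ and $\mathrm{tr}(U_m)\ne0$ for all $r,m$. With the whitening factors held fixed at their true values, define, for sample size $n$, $$M_r(\Psi)=\frac{1}{n\,\mathrm{tr}(W_r)}\sum_{k=1}^n(\mathfrak{X}^{(k)})^\top\Psi^{-1/2}W_r\Psi^{-1/2}\mathfrak{X}^{(k)},\qquad N_m(\Sigma)=\frac{1}{n\,\mathrm{tr}(U_m)}\sum_{k=1}^n\mathfrak{X}^{(k)}\Sigma^{-1/2}U_m\Sigma^{-1/2}(\mathfrak{X}^{(k)})^\top.$$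 For each $m\in\{1,\dots,M\}$ and $r\in\{1,\dots,R\}$ form the structured Stein moment equations (in the unknowns $\boldsymbol\beta\in\mathbb{R}^p$, $\boldsymbol\alpha\in\mathbb{R}^q$) $$\mathrm{tr}\{\Sigma(\boldsymbol\beta)U_m\}=y^{(\Sigma)}_m:=\frac1R\sum_{r=1}^R\mathrm{tr}\{M_r(\Psi)U_m\},\qquad \mathrm{tr}\{\Psi(\boldsymbol\alpha)W_r\}=y^{(\Psi)}_r:=\frac1M\sum_{m=1}^M\mathrm{tr}\{N_m(\Sigma)W_r\},$$ and set $\boldsymbol y^{(\Sigma)}=(y^{(\Sigma)}_1,\dots,y^{(\Sigma)}_M)^\top$, $\boldsymbol y^{(\Psi)}=(y^{(\Psi)}_1,\dots,y^{(\Psi)}_R)^\top$. Let $C^{(\Sigma)}\in\mathbb{R}^{M\times p}$ and $C^{(\Psi)}\in\mathbb{R}^{R\times q}$ have entries $C^{(\Sigma)}_{mj}=\mathrm{tr}(B_jU_m)$ and $C^{(\Psi)}_{r\ell}=\mathrm{tr}(A_\ell W_r)$. If $C^{(\Sigma)}$ and $C^{(\Psi)}$ have full column rank, then the least-squares solutions $$\widehat{\boldsymbol\beta}=\arg\min_{\boldsymbol\beta\in\mathbb{R}^p}\|C^{(\Sigma)}\boldsymbol\beta-\boldsymbol y^{(\Sigma)}\|_2^2,\qquad \widehat{\boldsymbol\alpha}=\arg\min_{\boldsymbol\alpha\in\mathbb{R}^q}\|C^{(\Psi)}\boldsymbol\alpha-\boldsymbol y^{(\Psi)}\|_2^2$$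 are strongly consistent for $\boldsymbol\beta^\star$ and $\boldsymbol\alpha^\star$, i.e. $\widehat{\boldsymbol\beta}\to\boldsymbol\beta^\star$ and $\widehat{\boldsymbol\alpha}\to\boldsymbol\alpha^\star$ almost surely as $n\to\infty$. In particular, $\widehat\Sigma=\Sigma(\widehat{\boldsymbol\beta})$ and $\widehat\Psi=\Psi(\widehat{\boldsymbol\alpha})$ converge almost surely to $\Sigma$ and $\Psi$, and they solve the structured Stein moment equations above in the least-squares sense.
   Context: $\mathcal{S}^d$ and $\mathcal{S}^d_{++}$ denote the sets of real symmetric and real symmetric positive definite $d\times d$ matrices. $S^{-1/2}$ is the inverse of the symmetric square root of $S$. $\mathfrak{N}\sim\mathcal{N}_{\nu\times d}(M,\Psi\otimes\Sigma)$ means $\mathrm{vec}(\mathfrak{N}^\top)\sim\mathcal{N}_{\nu d}(\mathrm{vec}(M^\top),\Psi\otimes\Sigma)$ ($\mathrm{vec}$ stacks columns, $\otimes$ is the Kronecker product). $\|\cdot\|_2$ applied to vectors is the Euclidean norm. *)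

theory Defs
  imports "HOL-Probability.Probability"
begin

definition sym_mats :: "(real^'n^'n) set" where
  "sym_mats = {S. transpose S = S}"

definition psd_mats :: "(real^'n^'n) set" where
  "psd_mats = {S \<in> sym_mats. \<forall>x. 0 \<le> x \<bullet> (S *v x)}"

definition pd_mats :: "(real^'n^'n) set" where
  "pd_mats = {S \<in> sym_mats. \<forall>x. x \<noteq> 0 \<longrightarrow> 0 < x \<bullet> (S *v x)}"

text \<open>The symmetric square root is the positive semidefinite one; a symmetric matrix
  may have other, indefinite, symmetric roots.\<close>

definition sym_sqrt :: "real^'n^'n \<Rightarrow> real^'n^'n" where
  "sym_sqrt S = (THE Q. Q \<in> psd_mats \<and> Q ** Q = S)"

definition inv_sqrt :: "real^'n^'n \<Rightarrow> real^'n^'n" where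
  "inv_sqrt S = matrix_inv (sym_sqrt S)"

text \<open>The entries of an (n m)-dimensional vector are indexed by pairs, to be read
  in lexicographic order. The first component of the index of \<open>stack_columns A\<close> is the
  column (block) number, the second the position inside that column; the first
  component of an index of \<open>kron A B\<close> is the block number.\<close>

definition stack_columns :: "real^'n^'m \<Rightarrow> real^('n \<times> 'm)" where
  "stack_columns A = (\<chi> ji. A $ snd ji $ fst ji)"

definition kron :: "real^'a^'b \<Rightarrow> real^'c^'d \<Rightarrow> real^('a \<times> 'c)^('b \<times> 'd)" where
  "kron A B = (\<chi> i j. A $ fst i $ fst j * B $ snd i $ snd j)"

text \<open>Density of the nondegenerate normal law with mean \<open>\<mu>\<close> and covariance \<open>V\<close>;
  meaningful for \<open>V \<in> pd_mats\<close>.\<close>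

definition mvn_density :: "real^'n \<Rightarrow> real^'n^'n \<Rightarrow> real^'n \<Rightarrow> real" where
  "mvn_density \<mu> V x =
     exp (- ((x - \<mu>) \<bullet> (matrix_inv V *v (x - \<mu>))) / 2) / sqrt ((2 * pi) ^ CARD('n) * det V)"

definition matrix_normal ::
  "'w measure \<Rightarrow> ('w \<Rightarrow> real^'d^'v) \<Rightarrow> real^'d^'v \<Rightarrow> real^'v^'v \<Rightarrow> real^'d^'d \<Rightarrow> bool" where
  "matrix_normal P X m \<Psi> S \<longleftrightarrow>
     distributed P lborel (\<lambda>\<omega>. stack_columns (transpose (X \<omega>)))
       (\<lambda>x. ennreal (mvn_density (stack_columns (transpose m)) (kron \<Psi> S) x))"

definition structured :: "('p::finite \<Rightarrow> real^'n^'n) \<Rightarrow> real^'p \<Rightarrow> real^'n^'n" where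
  "structured B \<beta> = (\<Sum>j\<in>UNIV. \<beta> $ j *\<^sub>R B j)"

text \<open>The sequence of observations is \<open>X 1, X 2, \<dots>\<close>; the value \<open>X 0\<close> is never used.
  In the following two definitions \<open>\<Psi>\<close>, \<open>S\<close> are the true scale matrices.\<close>

definition row_moment ::
  "(nat \<Rightarrow> 'w \<Rightarrow> real^'d^'v) \<Rightarrow> real^'v^'v \<Rightarrow> real^'v^'v \<Rightarrow> nat \<Rightarrow> 'w \<Rightarrow> real^'d^'d" where
  "row_moment X \<Psi> W n \<omega> = (1 / (real n * trace W)) *\<^sub>R
     (\<Sum>k=1..n. transpose (X k \<omega>) ** inv_sqrt \<Psi> ** W ** inv_sqrt \<Psi> ** X k \<omega>)"

definition col_moment ::
  "(nat \<Rightarrow> 'w \<Rightarrow> real^'d^'v) \<Rightarrow> real^'d^'d \<Rightarrow> real^'d^'d \<Rightarrow> nat \<Rightarrow> 'w \<Rightarrow> real^'v^'v" where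
  "col_moment X S U n \<omega> = (1 / (real n * trace U)) *\<^sub>R
     (\<Sum>k=1..n. X k \<omega> ** inv_sqrt S ** U ** inv_sqrt S ** transpose (X k \<omega>))"

definition y_Sigma ::
  "(nat \<Rightarrow> 'w \<Rightarrow> real^'d^'v) \<Rightarrow> real^'v^'v \<Rightarrow> ('r::finite \<Rightarrow> real^'v^'v) \<Rightarrow> ('m::finite \<Rightarrow> real^'d^'d)
     \<Rightarrow> nat \<Rightarrow> 'w \<Rightarrow> real^'m" where
  "y_Sigma X \<Psi> W U n \<omega> =
     (\<chi> m. (1 / real CARD('r)) * (\<Sum>r\<in>UNIV. trace (row_moment X \<Psi> (W r) n \<omega> ** U m)))"

definition y_Psi ::
  "(nat \<Rightarrow> 'w \<Rightarrow> real^'d^'v) \<Rightarrow> real^'d^'d \<Rightarrow> ('r::finite \<Rightarrow> real^'v^'v) \<Rightarrow> ('m::finite \<Rightarrow> real^'d^'d)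
     \<Rightarrow> nat \<Rightarrow> 'w \<Rightarrow> real^'r" where
  "y_Psi X S W U n \<omega> =
     (\<chi> r. (1 / real CARD('m)) * (\<Sum>m\<in>UNIV. trace (col_moment X S (U m) n \<omega> ** W r)))"

definition design_matrix :: "('p::finite \<Rightarrow> real^'n^'n) \<Rightarrow> ('m::finite \<Rightarrow> real^'n^'n) \<Rightarrow> real^'p^'m" where
  "design_matrix B U = (\<chi> m j. trace (B j ** U m))"

definition lsq_objective :: "real^'p^'m \<Rightarrow> real^'m \<Rightarrow> real^'p \<Rightarrow> real" where
  "lsq_objective C y b = (norm (C *v b - y))\<^sup>2"

definition least_squares :: "real^'p^'m \<Rightarrow> real^'m \<Rightarrow> real^'p" where
  "least_squares C y = arg_min (lsq_objective C y) (\<lambda>_. True)"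

definition beta_hat ::
  "(nat \<Rightarrow> 'w \<Rightarrow> real^'d^'v) \<Rightarrow> real^'v^'v \<Rightarrow> ('p::finite \<Rightarrow> real^'d^'d)
     \<Rightarrow> ('r::finite \<Rightarrow> real^'v^'v) \<Rightarrow> ('m::finite \<Rightarrow> real^'d^'d) \<Rightarrow> nat \<Rightarrow> 'w \<Rightarrow> real^'p" where
  "beta_hat X \<Psi> B W U n \<omega> = least_squares (design_matrix B U) (y_Sigma X \<Psi> W U n \<omega>)"

definition alpha_hat ::
  "(nat \<Rightarrow> 'w \<Rightarrow> real^'d^'v) \<Rightarrow> real^'d^'d \<Rightarrow> ('q::finite \<Rightarrow> real^'v^'v)
     \<Rightarrow> ('r::finite \<Rightarrow> real^'v^'v) \<Rightarrow> ('m::finite \<Rightarrow> real^'d^'d) \<Rightarrow> nat \<Rightarrow> 'w \<Rightarrow> real^'q" where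
  "alpha_hat X S A W U n \<omega> = least_squares (design_matrix A W) (y_Psi X S W U n \<omega>)"

text \<open>Sum of squared residuals of the moment equations \<open>tr(S U\<^sub>m) = y\<^sub>m\<close>.\<close>

definition moment_residual :: "('m::finite \<Rightarrow> real^'n^'n) \<Rightarrow> real^'m \<Rightarrow> real^'n^'n \<Rightarrow> real" where
  "moment_residual U y S = (\<Sum>m\<in>UNIV. (trace (S ** U m) - y $ m)\<^sup>2)"

end

theory Submission
  imports Defs "HOL-Library.Discrete_Functions"
begin

text \<open>By the strong law of large numbers the empirical second moments of the entries converge almost
  surely to the entries of \<open>kron \<Psi> S\<close>. Whitening cancels the known factor, so the moment vectors
  converge to \<open>C *v \<beta>\<close> and \<open>C *v \<alpha>\<close> for the respective design matrices, and an injective design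
  matrix turns convergence of the data into convergence of the least-squares solution, since
  \<open>norm (C *v (b - \<beta>)) \<le> 2 * norm (y - C *v \<beta>)\<close> for the minimiser \<open>b\<close>.\<close>

subsection \<open>Least squares and the design matrix\<close>

text \<open>Two notions come without ready-made properties: \<open>sym_sqrt\<close> is a definite
  description, so a root must be shown to exist and be unique, which is done through an orthonormal
  eigenbasis; and the normal law is known only by its density, so every moment must be extracted
  from that density. The quantities averaged are products of two matrix entries. A strong law based
  on second moments asks for their squares to be integrable, which is a fourth-moment statement
  about the normal law; finite exponential moments in every direction supply it together with the
  covariances. Entries are the right unit because their covariance
  \<open>\<Psi> $ a $ b * S $ i $ j\<close> factorises: a trace that is bilinear in the sample has a
  limit that is a product of two traces, one for each scale matrix. Whitening turns one of them into
  \<open>trace (W r)\<close> or \<open>trace (U m)\<close>, which is the normaliser in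
  \<open>row_moment\<close> and \<open>col_moment\<close>.\<close>

lemma arg_min_least_squares_unique:
  fixes C :: "real^'p^'m"
  assumes inj: "inj ((*v) C)"
  shows "is_arg_min (lsq_objective C y) (\<lambda>_. True) b \<longleftrightarrow> b = least_squares C y"
proof -
  let ?R = "range ((*v) C)"
  let ?c = "closest_point ?R y"
  have cl: "closed ?R" and ne: "?R \<noteq> {}" and cv: "convex ?R"
    by (auto intro!: closed_subspace subspace_imp_convex linear_subspace_image)
  \<comment> \<open>Minimisers are the preimages of the projection of \<open>y\<close> onto the
    closed convex range. Existence is settled before \<open>least_squares\<close> is mentioned,
    since \<open>arg_min\<close> is a choice operator; injectivity then leaves one preimage.\<close>
  have min_iff: "is_arg_min (lsq_objective C y) (\<lambda>_. True) b \<longleftrightarrow> C *v b = ?c" for b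
  proof -
    have "is_arg_min (lsq_objective C y) (\<lambda>_. True) b \<longleftrightarrow> (\<forall>z\<in>?R. dist y (C *v b) \<le> dist y z)"
      by (auto simp: is_arg_min_linorder lsq_objective_def dist_norm norm_minus_commute)
    also have "\<dots> \<longleftrightarrow> C *v b = ?c"
      using closest_point_unique[OF cv cl, of "C *v b" y] closest_point_le[OF cl, of _ y] by auto
    finally show ?thesis .
  qed
  obtain b0 where b0: "C *v b0 = ?c"
    using closest_point_in_set[OF cl ne, of y] by auto
  have "is_arg_min (lsq_objective C y) (\<lambda>_. True) (least_squares C y)"
    unfolding least_squares_def arg_min_def using b0 min_iff by (metis someI)
  then show ?thesis
    using min_iff inj by (metis injD)
qed

lemma least_squares_consistent:
  fixes C :: "real^'p^'m"
  assumes inj: "inj ((*v) C)" and lim: "y \<longlonglongrightarrow> C *v b"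
  shows "(\<lambda>n. least_squares C (y n)) \<longlonglongrightarrow> b"
proof -
  obtain K where K: "K > 0" "\<And>x. K * norm x \<le> norm (C *v x)"
    using linear_inj_bounded_below_pos[of "(*v) C"] inj by auto
  have bound: "norm (least_squares C (y n) - b) \<le> 2 / K * norm (y n - C *v b)" for n
  proof -
    let ?h = "least_squares C (y n)"
    have "is_arg_min (lsq_objective C (y n)) (\<lambda>_. True) ?h"
      by (simp add: arg_min_least_squares_unique[OF inj])
    then have le: "norm (C *v ?h - y n) \<le> norm (C *v b - y n)"
      by (auto simp: is_arg_min_linorder lsq_objective_def)
    have "K * norm (?h - b) \<le> norm (C *v ?h - C *v b)"
      using K(2)[of "?h - b"] by (simp add: matrix_vector_mult_diff_distrib)
    also have "\<dots> \<le> norm (C *v ?h - y n) + norm (C *v b - y n)"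
      by (rule norm_triangle_ineq4[of "C *v ?h - y n" "C *v b - y n", simplified])
    also have "\<dots> \<le> 2 * norm (y n - C *v b)"
      using le by (simp add: norm_minus_commute)
    finally show ?thesis using K(1) by (simp add: field_simps)
  qed
  have "(\<lambda>n. y n - C *v b) \<longlonglongrightarrow> 0"
    using lim by (simp add: LIM_zero)
  then have "(\<lambda>n. 2 / K * norm (y n - C *v b)) \<longlonglongrightarrow> 0"
    by (intro tendsto_mult_right_zero tendsto_norm_zero)
  then have "(\<lambda>n. least_squares C (y n) - b) \<longlonglongrightarrow> 0"
    by (rule Lim_null_comparison[OF always_eventually[OF allI[OF bound]]])
  then show ?thesis by (simp add: LIM_zero_iff)
qed

lemma matrix_add_rdistrib: "((A + B) ** C) = (A ** C) + (B ** C)"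
  by (vector matrix_matrix_mult_def sum.distrib[symmetric] field_simps)

lemma trace_mult_sum_left:
  "trace ((\<Sum>i\<in>I. c i *\<^sub>R (A i :: real^'n^'n)) ** B) = (\<Sum>i\<in>I. c i * trace (A i ** B))"
proof (induction I rule: infinite_finite_induct)
  case (insert i I)
  then show ?case
    by (simp add: matrix_add_rdistrib trace_add scalar_matrix_assoc[symmetric])
      (simp add: trace_def sum_distrib_left)
qed (simp_all add: trace_def)

lemma design_matrix_mult:
  "(design_matrix B U *v b) $ m = trace (structured B b ** U m)"
  by (simp add: design_matrix_def structured_def trace_mult_sum_left matrix_vector_mult_def
      mult.commute)

text \<open>The moment equations are linear in the coefficients, so minimality over structured
  matrices can be read off from minimality over coefficient vectors.\<close>

lemma moment_residual_structured:
  "moment_residual U y (structured B b) = lsq_objective (design_matrix B U) y b"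
  unfolding moment_residual_def lsq_objective_def power2_norm_eq_inner
  by (simp add: inner_vec_def design_matrix_mult power2_eq_square)

lemma structured_tendsto:
  "(b \<longlongrightarrow> b0) F \<Longrightarrow> ((\<lambda>n. structured B (b n)) \<longlongrightarrow> structured B b0) F"
  unfolding structured_def by (intro tendsto_intros)

subsection \<open>The symmetric square root\<close>

lemma self_adjoint_dot:
  assumes "A \<in> sym_mats"
  shows "x \<bullet> (A *v y) = (A *v x) \<bullet> y"
proof -
  have "transpose A = A" using assms by (simp add: sym_mats_def)
  then show ?thesis by (metis dot_lmul_matrix vector_transpose_matrix)
qed

text \<open>Near 0 the linear term dominates, and the sign of \<open>s\<close> is free. This is the
  first-order condition at a maximum, phrased without derivatives.\<close>

lemma quadratic_nonpos_imp_linear_zero: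
  fixes a b :: real
  assumes "\<And>s. 2 * s * a + s\<^sup>2 * b \<le> 0"
  shows "a = 0"
proof (rule ccontr)
  assume "a \<noteq> 0"
  \<comment> \<open>The test point is \<open>s = a / d\<close>; any positive \<open>d\<close> with
    \<open>2 * d + b > 0\<close> would do.\<close>
  define d where "d = 1 + \<bar>b\<bar>"
  have d: "d > 0" "- b < d" by (auto simp: d_def)
  have "2 * (a / d) * a + (a / d)\<^sup>2 * b = (a / d)\<^sup>2 * (2 * d + b)"
    using d(1) by (simp add: field_simps power2_eq_square)
  also have "\<dots> > 0" using \<open>a \<noteq> 0\<close> d by (intro mult_pos_pos) auto
  finally show False using assms[of "a / d"] by simp
qed

text \<open>The maximiser of the quadratic form on the unit sphere of the invariant subspace is an
  eigenvector.\<close>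

lemma self_adjoint_eigenvector:
  fixes A :: "real^'n^'n"
  assumes A: "A \<in> sym_mats" and T: "subspace T" "\<And>x. x \<in> T \<Longrightarrow> A *v x \<in> T"
    and nz: "z \<in> T" "z \<noteq> 0"
  obtains v c where "v \<in> T" "norm v = 1" "A *v v = c *\<^sub>R v"
proof -
  let ?K = "sphere 0 1 \<inter> T"
  have "compact ?K"
    by (intro compact_Int_closed closed_subspace T) auto
  moreover have "(1 / norm z) *\<^sub>R z \<in> ?K"
    using nz T by (auto intro: subspace_scale)
  then have "?K \<noteq> {}" by blast
  moreover have "continuous_on ?K (\<lambda>x. x \<bullet> (A *v x))"
    by (intro continuous_intros)
  ultimately obtain v where v: "v \<in> ?K" "\<And>x. x \<in> ?K \<Longrightarrow> x \<bullet> (A *v x) \<le> v \<bullet> (A *v v)"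
    using continuous_attains_sup[of ?K "\<lambda>x. x \<bullet> (A *v x)"] by blast
  define c where "c = v \<bullet> (A *v v)"
  have le: "x \<bullet> (A *v x) \<le> c * (x \<bullet> x)" if "x \<in> T" for x
  proof (cases "x = 0")
    case False
    let ?u = "(1 / norm x) *\<^sub>R x"
    have "?u \<in> ?K" using that False T by (auto intro: subspace_scale)
    from v(2)[OF this] have "(x \<bullet> (A *v x)) / (norm x)\<^sup>2 \<le> c"
      by (simp add: c_def matrix_vector_mult_scaleR power2_eq_square)
    then show ?thesis
      using False by (simp add: field_simps power2_norm_eq_inner)
  qed auto
  define w where "w = A *v v - c *\<^sub>R v"
  have vT: "v \<in> T" and vv: "v \<bullet> v = 1" using v(1) by (auto simp: norm_eq_1)
  have wT: "w \<in> T" unfolding w_def using T vT by (intro subspace_diff subspace_scale) auto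
  \<comment> \<open>The eigenvector residual \<open>w\<close> itself serves as the direction of
    perturbation: inserting \<open>v + s *\<^sub>R w\<close> into \<open>le\<close>, the term linear
    in \<open>s\<close> is \<open>2 * s * (w \<bullet> w)\<close>.\<close>
  have "w \<bullet> w = 0"
  proof (rule quadratic_nonpos_imp_linear_zero[where b = "w \<bullet> (A *v w) - c * (w \<bullet> w)"])
    fix s :: real
    let ?x = "v + s *\<^sub>R w"
    have e1: "?x \<bullet> (A *v ?x) = c + 2 * s * (w \<bullet> (A *v v)) + s\<^sup>2 * (w \<bullet> (A *v w))"
      using self_adjoint_dot[OF A, of v w]
      by (simp add: c_def matrix_vector_right_distrib matrix_vector_mult_scaleR inner_simps
          power2_eq_square inner_commute algebra_simps)
    have e2: "?x \<bullet> ?x = 1 + 2 * s * (w \<bullet> v) + s\<^sup>2 * (w \<bullet> w)"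
      using vv by (simp add: inner_simps power2_eq_square inner_commute algebra_simps)
    have e3: "w \<bullet> (A *v v) = w \<bullet> w + c * (w \<bullet> v)"
      by (simp add: w_def inner_simps algebra_simps)
    have "?x \<bullet> (A *v ?x) \<le> c * (?x \<bullet> ?x)"
      using vT wT T by (intro le subspace_add subspace_scale) auto
    then show "2 * s * (w \<bullet> w) + s\<^sup>2 * (w \<bullet> (A *v w) - c * (w \<bullet> w)) \<le> 0"
      unfolding e1 e2 e3 by (simp add: algebra_simps)
  qed
  then have "A *v v = c *\<^sub>R v" by (simp add: w_def)
  then show ?thesis using that v(1) by auto
qed

text \<open>An orthonormal set of eigenvectors of greatest cardinality must span: its orthogonal
  complement is invariant because \<open>A\<close> is self-adjoint, and if nonzero it would contain
  one more unit eigenvector.\<close>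

lemma symmetric_orthonormal_eigenbasis:
  fixes A :: "real^'n^'n"
  assumes A: "A \<in> sym_mats"
  obtains E c where "finite E" "span E = UNIV" "pairwise orthogonal E"
    "\<And>e. e \<in> E \<Longrightarrow> norm e = 1" "\<And>e. e \<in> E \<Longrightarrow> A *v e = c e *\<^sub>R e"
proof -
  define Q where "Q E \<longleftrightarrow> pairwise orthogonal E \<and> (\<forall>e\<in>E. norm e = 1 \<and> (\<exists>c. A *v e = c *\<^sub>R e))"
    for E :: "(real^'n) set"
  have indep: "independent E" if "Q E" for E
    using that by (intro pairwise_orthogonal_independent) (auto simp: Q_def)
  have Q_empty: "Q {}" by (simp add: Q_def)
  have bdd: "\<forall>E. Q E \<longrightarrow> card E < Suc DIM(real^'n)"
    using indep independent_card_le by (metis le_imp_less_Suc)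
  obtain E where E: "Q E" and max: "\<And>F. Q F \<Longrightarrow> card F \<le> card E"
    using ex_has_greatest_nat[of Q, OF Q_empty bdd] by blast
  have fin: "finite E" using indep[OF E] independent_imp_finite by blast
  have "span E = UNIV"
  proof (rule ccontr)
    assume "span E \<noteq> UNIV"
    then obtain z where z: "z \<noteq> 0" "\<And>x. x \<in> span E \<Longrightarrow> z \<bullet> x = 0"
      using span_not_UNIV_orthogonal by blast
    define T where "T = {x. \<forall>e\<in>E. e \<bullet> x = 0}"
    have T: "subspace T"
      by (auto simp: T_def subspace_def inner_simps)
    have inv: "A *v x \<in> T" if "x \<in> T" for x
      using that E by (auto simp: T_def Q_def self_adjoint_dot[OF A])
    have "z \<in> T" using z by (auto simp: T_def inner_commute span_base)
    then obtain v d where v: "v \<in> T" "norm v = 1" "A *v v = d *\<^sub>R v"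
      using self_adjoint_eigenvector[OF A T inv] z(1) by blast
    have "v \<notin> E" using v by (auto simp: T_def)
    have "Q (insert v E)"
      using E v by (auto simp: Q_def T_def pairwise_insert orthogonal_def inner_commute)
    from max[OF this] show False using \<open>v \<notin> E\<close> fin by simp
  qed
  moreover obtain c where "\<And>e. e \<in> E \<Longrightarrow> A *v e = c e *\<^sub>R e"
    using E unfolding Q_def by metis
  ultimately show ?thesis
    using E fin by (intro that[of E c]) (auto simp: Q_def)
qed

lemma matrix_eq_on_span:
  fixes A B :: "real^'n^'m"
  assumes "span E = UNIV" "\<And>e. e \<in> E \<Longrightarrow> A *v e = B *v e"
  shows "A = B"
proof -
  have "A *v x = B *v x" for x
    using linear_eq_on_span[of "(*v) A" "(*v) B" E x] assms by auto
  then show ?thesis by (simp add: matrix_eq)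
qed

text \<open>Existence takes the root of each eigenvalue in an eigenbasis of \<open>S\<close>.
  Uniqueness shows that any other root acts in the same way on each vector of that basis.\<close>

lemma psd_sqrt_exists_unique:
  fixes S :: "real^'n^'n"
  assumes S: "S \<in> psd_mats"
  shows "\<exists>!Q. Q \<in> psd_mats \<and> Q ** Q = S"
proof -
  have sym: "S \<in> sym_mats" using S by (simp add: psd_mats_def)
  obtain E c where E: "finite E" "span E = UNIV" "pairwise orthogonal E"
    "\<And>e. e \<in> E \<Longrightarrow> norm e = 1" "\<And>e. e \<in> E \<Longrightarrow> S *v e = c e *\<^sub>R e"
    using symmetric_orthonormal_eigenbasis[OF sym] by metis
  have c: "c e \<ge> 0" if "e \<in> E" for e
  proof -
    have "0 \<le> e \<bullet> (S *v e)" using S by (simp add: psd_mats_def)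
    then show ?thesis using E(4,5)[OF that] by (simp add: norm_eq_1)
  qed
  define Q where "Q = (\<chi> i j. \<Sum>e\<in>E. sqrt (c e) * e $ i * e $ j)"
  have Qx: "Q *v x = (\<Sum>e\<in>E. (sqrt (c e) * (e \<bullet> x)) *\<^sub>R e)" for x
    unfolding Q_def
    by (simp add: vec_eq_iff matrix_vector_mult_def inner_vec_def sum_distrib_left sum_distrib_right
        sum.swap[of _ E UNIV] mult_ac)
  have Qe: "Q *v e = sqrt (c e) *\<^sub>R e" if e: "e \<in> E" for e
  proof -
    have "(sqrt (c f) * (f \<bullet> e)) *\<^sub>R f = (if f = e then sqrt (c e) *\<^sub>R e else 0)" if "f \<in> E" for f
      using that e E(3) E(4)[OF e] by (auto simp: pairwise_def orthogonal_def norm_eq_1)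
    then show ?thesis using e E(1) by (simp add: Qx)
  qed
  have "x \<bullet> (Q *v x) = (\<Sum>e\<in>E. sqrt (c e) * (e \<bullet> x)\<^sup>2)" for x
    by (simp add: Qx inner_sum_right power2_eq_square inner_commute mult_ac)
  then have "0 \<le> x \<bullet> (Q *v x)" for x
    using c by (auto intro!: sum_nonneg)
  moreover have "transpose Q = Q"
    by (simp add: Q_def transpose_def mult_ac)
  ultimately have Q1: "Q \<in> psd_mats"
    by (simp add: psd_mats_def sym_mats_def)
  have Q2: "Q ** Q = S"
    by (rule matrix_eq_on_span[OF E(2)])
      (use c in \<open>simp add: matrix_vector_mul_assoc[symmetric] Qe matrix_vector_mult_scaleR E\<close>)
  have "R = Q" if R: "R \<in> psd_mats" "R ** R = S" for R
  proof (rule matrix_eq_on_span[OF E(2)])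
    fix e assume e: "e \<in> E"
    have RR: "R *v (R *v x) = S *v x" for x using R(2) by (simp add: matrix_vector_mul_assoc)
    have Rsym: "R \<in> sym_mats" and Rpos: "0 \<le> x \<bullet> (R *v x)" for x
      using R by (auto simp: psd_mats_def)
    define s where "s = sqrt (c e)"
    have ss: "s * s = c e" "s \<ge> 0" using c[OF e] by (auto simp: s_def)
    \<comment> \<open>Since \<open>R\<close> squared minus \<open>s\<close> squared annihilates
      \<open>e\<close>, the vector \<open>u\<close> satisfies
      \<open>R *v u = - s *\<^sub>R u\<close>. For \<open>s > 0\<close> a nonzero \<open>u\<close>
      would contradict positivity of \<open>R\<close>; for \<open>s = 0\<close>, the squared norm of
      \<open>u = R *v e\<close> is \<open>e \<bullet> (S *v e) = 0\<close>.\<close>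
    define u where "u = R *v e - s *\<^sub>R e"
    have "R *v u = - s *\<^sub>R u"
      by (simp add: u_def matrix_vector_mult_diff_distrib RR matrix_vector_mult_scaleR
          E(5)[OF e] ss(1)[symmetric] algebra_simps)
    then have su: "s * (u \<bullet> u) \<le> 0" using Rpos[of u] by simp
    have "u = 0"
    proof (cases "s = 0")
      case True
      have "u \<bullet> u = e \<bullet> (R *v (R *v e))"
        using True by (simp add: u_def self_adjoint_dot[OF Rsym, of e])
      also have "\<dots> = 0" using True ss by (simp add: RR E(5)[OF e])
      finally show ?thesis by simp
    next
      case False
      then have "u \<bullet> u \<le> 0" using su ss(2) by (simp add: mult_le_0_iff)
      then show ?thesis by (metis inner_eq_zero_iff inner_ge_zero order_antisym)
    qed
    then show "R *v e = Q *v e" by (simp add: u_def Qe[OF e] s_def)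
  qed
  then show ?thesis using Q1 Q2 by blast
qed

section \<open>Whitening by the inverse square root\<close>

lemma matrix_inv_mult:
  assumes "invertible A"
  shows "A ** matrix_inv A = mat 1" "matrix_inv A ** A = mat 1"
  using someI_ex[OF assms[unfolded invertible_def]] by (auto simp: matrix_inv_def)

lemma pd_mats_invertible:
  fixes S :: "real^'n^'n"
  assumes "S \<in> pd_mats"
  shows "invertible S"
proof -
  have "inj ((*v) S)"
  proof (rule linear_injective_0[THEN iffD2, rule_format])
    fix x assume "S *v x = 0"
    then show "x = 0" using assms by (auto simp: pd_mats_def dest: spec[of _ x])
  qed auto
  then show ?thesis
    by (metis invertible_left_inverse matrix_left_invertible_injective)
qed

lemma sym_sqrt_psd:
  assumes "S \<in> psd_mats"
  shows "sym_sqrt S \<in> psd_mats" "sym_sqrt S ** sym_sqrt S = S"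
  using theI'[OF psd_sqrt_exists_unique[OF assms]] by (auto simp: sym_sqrt_def)

lemma inv_sqrt_whitens:
  fixes S :: "real^'n^'n"
  assumes "S \<in> pd_mats"
  shows "inv_sqrt S ** S ** inv_sqrt S = mat 1"
proof -
  let ?Q = "sym_sqrt S"
  have "S \<in> psd_mats"
    using assms by (auto simp: pd_mats_def psd_mats_def) (metis inner_zero_left less_imp_le order_refl)
  then have Q: "?Q ** ?Q = S" by (rule sym_sqrt_psd)
  have "invertible ?Q"
    using pd_mats_invertible[OF assms] Q by (metis det_mul invertible_det_nz mult_zero_left)
  then have inv: "?Q ** inv_sqrt S = mat 1" "inv_sqrt S ** ?Q = mat 1"
    unfolding inv_sqrt_def by (simp_all add: matrix_inv_mult)
  have "inv_sqrt S ** S ** inv_sqrt S = (inv_sqrt S ** ?Q) ** (?Q ** inv_sqrt S)"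
    by (metis Q matrix_mul_assoc)
  then show ?thesis by (simp add: inv)
qed

subsection \<open>A strong law of large numbers\<close>

text \<open>The sum in the numerator controls the whole block of partial sums between consecutive squares.\<close>

lemma average_tendsto_zero_of_square_blocks:
  fixes s :: "nat \<Rightarrow> real"
  assumes "(\<lambda>n. ((s (n\<^sup>2))\<^sup>2 + (\<Sum>m\<in>{n\<^sup>2..(Suc n)\<^sup>2}. (s m - s (n\<^sup>2))\<^sup>2)) / real n ^ 4) \<longlonglongrightarrow> 0"
  shows "(\<lambda>m. s m / real m) \<longlonglongrightarrow> 0"
proof (rule LIMSEQ_I)
  fix \<epsilon> :: real assume \<epsilon>: "\<epsilon> > 0"
  define t where "t n = ((s (n\<^sup>2))\<^sup>2 + (\<Sum>m\<in>{n\<^sup>2..(Suc n)\<^sup>2}. (s m - s (n\<^sup>2))\<^sup>2)) / real n ^ 4" for n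
  have "t \<longlonglongrightarrow> 0" using assms by (simp add: t_def[abs_def])
  \<comment> \<open>The error is split evenly between the value at the last square and the deviation
    since then, hence \<open>\<epsilon> / 2\<close>.\<close>
  then obtain K where K: "\<And>n. n \<ge> K \<Longrightarrow> norm (t n - 0) < (\<epsilon> / 2)\<^sup>2"
    using \<epsilon> by (metis LIMSEQ_D half_gt_zero zero_less_power)
  have "norm (s m / real m - 0) < \<epsilon>" if m: "m \<ge> (Suc K)\<^sup>2" for m
  proof -
    define n where "n = floor_sqrt m"
    have n: "n\<^sup>2 \<le> m" "m < (Suc n)\<^sup>2"
      by (simp_all add: n_def Suc_floor_sqrt_power2_gt)
    \<comment> \<open>\<open>Suc K\<close> rather than \<open>K\<close> guarantees
      \<open>n > 0\<close>: the term \<open>t 0\<close> is 0 by division by zero and carries no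
      information.\<close>
    have nK: "n \<ge> Suc K" using m by (simp add: n_def le_floor_sqrt_iff)
    then have n0: "real n > 0" by simp
    have tn: "t n < (\<epsilon> / 2)\<^sup>2" using K[of n] nK by (simp add: abs_less_iff)
    have small: "\<bar>x\<bar> < \<epsilon> / 2 * real (n\<^sup>2)" if "x\<^sup>2 \<le> t n * real n ^ 4" for x
    proof -
      have "x\<^sup>2 < (\<epsilon> / 2)\<^sup>2 * real n ^ 4"
        using that tn n0 by (intro le_less_trans[OF that] mult_strict_right_mono) auto
      also have "\<dots> = (\<epsilon> / 2 * real (n\<^sup>2))\<^sup>2" by (simp add: power_divide power_mult_distrib flip: power_mult)
      finally show ?thesis
        using \<epsilon> n0 by (metis abs_le_square_iff abs_of_nonneg less_eq_real_def mult_nonneg_nonneg half_gt_zero not_le of_nat_0_le_iff)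
    qed
    have tt: "t n * real n ^ 4 = (s (n\<^sup>2))\<^sup>2 + (\<Sum>m\<in>{n\<^sup>2..(Suc n)\<^sup>2}. (s m - s (n\<^sup>2))\<^sup>2)"
      using n0 by (simp add: t_def)
    have "\<bar>s (n\<^sup>2)\<bar> < \<epsilon> / 2 * real (n\<^sup>2)"
      by (rule small) (unfold tt, simp add: sum_nonneg)
    moreover have "\<bar>s m - s (n\<^sup>2)\<bar> < \<epsilon> / 2 * real (n\<^sup>2)"
    proof (rule small)
      have "(s m - s (n\<^sup>2))\<^sup>2 \<le> (\<Sum>m\<in>{n\<^sup>2..(Suc n)\<^sup>2}. (s m - s (n\<^sup>2))\<^sup>2)"
        using n by (intro member_le_sum[of m _ "\<lambda>m. (s m - s (n\<^sup>2))\<^sup>2"]) auto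
      then show "(s m - s (n\<^sup>2))\<^sup>2 \<le> t n * real n ^ 4"
        unfolding tt by (smt (verit) zero_le_power2)
    qed
    ultimately have "\<bar>s m\<bar> < \<epsilon> * real (n\<^sup>2)" by linarith
    also have "\<dots> \<le> \<epsilon> * real m" using n(1) \<epsilon> by (intro mult_left_mono) (simp_all del: of_nat_power)
    finally show ?thesis
      using n(1) n0 by (cases "m = 0") (simp_all add: pos_divide_less_eq)
  qed
  then show "\<exists>M. \<forall>m\<ge>M. norm (s m / real m - 0) < \<epsilon>" by blast
qed

text \<open>The integral of the series is finite, so the series converges almost everywhere and its
  terms tend to 0. This does the work of Chebyshev with Borel-Cantelli in one step.\<close>

lemma AE_tendsto_zero_of_summable_integrals:
  fixes T :: "nat \<Rightarrow> 'a \<Rightarrow> real"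
  assumes T: "\<And>n. integrable M (T n)" "\<And>n x. 0 \<le> T n x"
    and b: "\<And>n. (\<integral>x. T n x \<partial>M) \<le> b n" "summable b"
  shows "AE x in M. (\<lambda>n. T n x) \<longlonglongrightarrow> 0"
proof -
  have meas [measurable]: "T n \<in> borel_measurable M" for n using T(1) by auto
  have b0: "0 \<le> b n" for n
    by (rule order_trans[OF Bochner_Integration.integral_nonneg b(1)]) (rule T)
  have "(\<integral>\<^sup>+x. (\<Sum>n. ennreal (T n x)) \<partial>M) = (\<Sum>n. \<integral>\<^sup>+x. ennreal (T n x) \<partial>M)"
    by (rule nn_integral_suminf) measurable
  also have "\<dots> = (\<Sum>n. ennreal (\<integral>x. T n x \<partial>M))"
    using T by (simp add: nn_integral_eq_integral)
  also have "\<dots> \<le> (\<Sum>n. ennreal (b n))"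
    by (intro suminf_le ennreal_leI b summableI)
  also have "\<dots> < \<infinity>"
    using b(2) b0 by (simp add: suminf_ennreal2)
  finally have "AE x in M. (\<Sum>n. ennreal (T n x)) \<noteq> \<infinity>"
    by (intro nn_integral_PInf_AE) (auto simp: less_top)
  then show ?thesis
    by eventually_elim (use T(2) in \<open>auto intro!: summable_LIMSEQ_zero summable_suminf_not_top\<close>)
qed

lemma integral_square_sum_uncorrelated:
  fixes Z :: "'i \<Rightarrow> 'a \<Rightarrow> real"
  assumes fin: "finite I"
    and int: "\<And>k l. k \<in> I \<Longrightarrow> l \<in> I \<Longrightarrow> integrable M (\<lambda>x. Z k x * Z l x)"
    and uncor: "\<And>k l. k \<in> I \<Longrightarrow> l \<in> I \<Longrightarrow> k \<noteq> l \<Longrightarrow> (\<integral>x. Z k x * Z l x \<partial>M) = 0"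
    and var: "\<And>k. k \<in> I \<Longrightarrow> (\<integral>x. Z k x * Z k x \<partial>M) \<le> c"
  shows "integrable M (\<lambda>x. (\<Sum>k\<in>I. Z k x)\<^sup>2)" "(\<integral>x. (\<Sum>k\<in>I. Z k x)\<^sup>2 \<partial>M) \<le> c * card I"
proof -
  have eq: "(\<Sum>k\<in>I. Z k x)\<^sup>2 = (\<Sum>k\<in>I. \<Sum>l\<in>I. Z k x * Z l x)" for x
    by (simp add: power2_eq_square sum_product)
  show "integrable M (\<lambda>x. (\<Sum>k\<in>I. Z k x)\<^sup>2)"
    unfolding eq using int by (intro Bochner_Integration.integrable_sum) auto
  have "(\<integral>x. (\<Sum>k\<in>I. Z k x)\<^sup>2 \<partial>M) = (\<Sum>k\<in>I. \<Sum>l\<in>I. \<integral>x. Z k x * Z l x \<partial>M)"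
    unfolding eq using int by (simp add: Bochner_Integration.integral_sum)
  also have "\<dots> = (\<Sum>k\<in>I. \<integral>x. Z k x * Z k x \<partial>M)"
  proof (rule sum.cong)
    fix k assume k: "k \<in> I"
    have "(\<Sum>l\<in>I. \<integral>x. Z k x * Z l x \<partial>M) = (\<Sum>l\<in>I. if l = k then \<integral>x. Z k x * Z k x \<partial>M else 0)"
      using uncor k by (intro sum.cong) auto
    then show "(\<Sum>l\<in>I. \<integral>x. Z k x * Z l x \<partial>M) = (\<integral>x. Z k x * Z k x \<partial>M)"
      using k fin by simp
  qed simp
  also have "\<dots> \<le> c * card I"
    using sum_bounded_above[OF var] by (simp add: mult.commute)
  finally show "(\<integral>x. (\<Sum>k\<in>I. Z k x)\<^sup>2 \<partial>M) \<le> c * card I" .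
qed

text \<open>At the squares, \<open>s x (n\<^sup>2)\<close> has second moment of order
  \<open>n\<^sup>2\<close>. A block up to the next square has about \<open>2 * n\<close> partial
  sums, each deviating from its start by a second moment of order \<open>n\<close>, so even their
  total is of order \<open>n\<^sup>2\<close>. Division by \<open>n ^ 4\<close> leaves a summable
  bound.\<close>

lemma strong_law_uncorrelated:
  fixes Z :: "nat \<Rightarrow> 'a \<Rightarrow> real"
  assumes int: "\<And>k l. k \<ge> 1 \<Longrightarrow> l \<ge> 1 \<Longrightarrow> integrable M (\<lambda>x. Z k x * Z l x)"
    and uncor: "\<And>k l. k \<ge> 1 \<Longrightarrow> l \<ge> 1 \<Longrightarrow> k \<noteq> l \<Longrightarrow> (\<integral>x. Z k x * Z l x \<partial>M) = 0"
    and var: "\<And>k. k \<ge> 1 \<Longrightarrow> (\<integral>x. Z k x * Z k x \<partial>M) \<le> c"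
  shows "AE x in M. (\<lambda>n. (\<Sum>k=1..n. Z k x) / real n) \<longlonglongrightarrow> 0"
proof -
  define s where "s x n = (\<Sum>k=1..n. Z k x)" for x n
  define T where "T n x = ((s x (n\<^sup>2))\<^sup>2 + (\<Sum>m\<in>{n\<^sup>2..(Suc n)\<^sup>2}. (s x m - s x (n\<^sup>2))\<^sup>2)) / real n ^ 4" for n x
  have c: "c \<ge> 0"
    by (rule order_trans[OF Bochner_Integration.integral_nonneg var[of 1]]) auto
  have s_diff: "s x m - s x n = (\<Sum>k\<in>{n<..m}. Z k x)" if "n \<le> m" for x m n
  proof -
    have "{1..m} = {1..n} \<union> {n<..m}" using that by auto
    then show ?thesis by (simp add: s_def sum.union_disjoint ivl_disj_int)
  qed
  note sq = integral_square_sum_uncorrelated[where M = M and Z = Z and c = c]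
  have block: "integrable M (\<lambda>x. (s x m - s x n)\<^sup>2)"
      "(\<integral>x. (s x m - s x n)\<^sup>2 \<partial>M) \<le> c * real (m - n)" if "n \<le> m" for m n
    unfolding s_diff[OF that] using sq[of "{n<..m}"] int uncor var by auto
  have s0: "s x 0 = 0" for x by (simp add: s_def)
  note start = block[of 0, unfolded s0 diff_0_right, simplified]
  have T_int: "integrable M (T n)" for n
    unfolding T_def[abs_def] by (intro Bochner_Integration.integrable_divide Bochner_Integration.integrable_add
        Bochner_Integration.integrable_sum start block) auto
  \<comment> \<open>13 is 1 for the start plus 12 for the block: with both endpoints it has
    \<open>2 * n + 2\<close> indices, each contributing at most \<open>c * (2 * n + 1)\<close>, and
    \<open>(2 * n + 2) * (2 * n + 1) \<le> 12 * n\<^sup>2\<close> once \<open>n \<ge> 1\<close>. At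
    \<open>n = 0\<close> both sides vanish by division by zero.\<close>
  have T_bound: "(\<integral>x. T n x \<partial>M) \<le> 13 * c * inverse ((real n)\<^sup>2)" for n
  proof (cases "n = 0")
    case False
    then have n: "real n \<ge> 1" by simp
    have "(\<Sum>m\<in>{n\<^sup>2..(Suc n)\<^sup>2}. \<integral>x. (s x m - s x (n\<^sup>2))\<^sup>2 \<partial>M)
        \<le> (\<Sum>m\<in>{n\<^sup>2..(Suc n)\<^sup>2}. c * real (2 * n + 1))"
    proof (rule sum_mono)
      fix m assume m: "m \<in> {n\<^sup>2..(Suc n)\<^sup>2}"
      have "(\<integral>x. (s x m - s x (n\<^sup>2))\<^sup>2 \<partial>M) \<le> c * real (m - n\<^sup>2)" using m by (intro block) auto
      also have "\<dots> \<le> c * real (2 * n + 1)"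
        using m c by (intro mult_left_mono of_nat_mono) (auto simp: power2_eq_square)
      finally show "(\<integral>x. (s x m - s x (n\<^sup>2))\<^sup>2 \<partial>M) \<le> c * real (2 * n + 1)" .
    qed
    also have "\<dots> = c * (real (2 * n + 2) * real (2 * n + 1))"
      by (simp add: power2_eq_square)
    also have "\<dots> \<le> c * (12 * (real n)\<^sup>2)"
    proof -
      have "real n \<le> real n * real n" "1 \<le> real n * real n"
        using n mult_mono[OF n n] by (simp_all add: mult_le_cancel_left1)
      then have "real (2 * n + 2) * real (2 * n + 1) \<le> 12 * (real n)\<^sup>2"
        by (simp add: power2_eq_square algebra_simps)
      then show ?thesis using c by (rule mult_left_mono)
    qed
    finally have tail: "(\<Sum>m\<in>{n\<^sup>2..(Suc n)\<^sup>2}. \<integral>x. (s x m - s x (n\<^sup>2))\<^sup>2 \<partial>M) \<le> c * (12 * (real n)\<^sup>2)" .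
    have "(\<integral>x. T n x \<partial>M) = ((\<integral>x. (s x (n\<^sup>2))\<^sup>2 \<partial>M)
        + (\<Sum>m\<in>{n\<^sup>2..(Suc n)\<^sup>2}. \<integral>x. (s x m - s x (n\<^sup>2))\<^sup>2 \<partial>M)) / real n ^ 4"
      unfolding T_def
      by (subst integral_divide_zero, subst Bochner_Integration.integral_add,
          (intro Bochner_Integration.integrable_sum start block; auto)+,
          subst Bochner_Integration.integral_sum, (intro block; auto)+, rule refl)
    also have "\<dots> \<le> (c * (real n)\<^sup>2 + c * (12 * (real n)\<^sup>2)) / real n ^ 4"
      using start(2)[of "n\<^sup>2"] tail by (intro divide_right_mono add_mono) auto
    also have "\<dots> = 13 * c * inverse ((real n)\<^sup>2)"
      using n by (simp add: field_simps power2_eq_square eval_nat_numeral)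
    finally show ?thesis .
  qed (simp add: T_def)
  have "AE x in M. (\<lambda>n. T n x) \<longlonglongrightarrow> 0"
    by (rule AE_tendsto_zero_of_summable_integrals[OF T_int _ T_bound])
      (auto simp: T_def intro!: divide_nonneg_nonneg add_nonneg_nonneg sum_nonneg summable_mult inverse_power_summable)
  then show ?thesis
  proof eventually_elim
    case (elim x)
    then show ?case
      using average_tendsto_zero_of_square_blocks[of "s x"] by (simp add: T_def s_def)
  qed
qed

text \<open>Independence enters through pairs: it makes the centred variables uncorrelated, with
  second moments at most \<open>c - \<mu>\<^sup>2\<close>.\<close>

lemma (in prob_space) strong_law_square_integrable:
  fixes Y :: "nat \<Rightarrow> 'a \<Rightarrow> real"
  assumes indep: "indep_vars (\<lambda>_. borel) Y {1..}"
    and sq: "\<And>k. k \<ge> 1 \<Longrightarrow> integrable M (\<lambda>x. (Y k x)\<^sup>2)"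
    and mean: "\<And>k. k \<ge> 1 \<Longrightarrow> expectation (Y k) = \<mu>"
    and second: "\<And>k. k \<ge> 1 \<Longrightarrow> expectation (\<lambda>x. (Y k x)\<^sup>2) \<le> c"
  shows "AE x in M. (\<lambda>n. (\<Sum>k=1..n. Y k x) / real n) \<longlonglongrightarrow> \<mu>"
proof -
  have meas: "Y k \<in> borel_measurable M" if "k \<ge> 1" for k
    using indep that by (auto simp: indep_vars_def)
  have int: "integrable M (Y k)" if "k \<ge> 1" for k
    using square_integrable_imp_integrable[OF meas sq] that by simp
  define Z where "Z k x = Y k x - \<mu>" for k x
  have ZZ: "Z k x * Z l x = Y k x * Y l x - \<mu> * Y k x - \<mu> * Y l x + \<mu>\<^sup>2" for k l x
    by (simp add: Z_def algebra_simps power2_eq_square)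
  have prod: "integrable M (\<lambda>x. Y k x * Y l x) \<and> expectation (\<lambda>x. Y k x * Y l x) = \<mu> * \<mu>"
    if "k \<ge> 1" "l \<ge> 1" "k \<noteq> l" for k l
  proof -
    have "indep_vars (\<lambda>_. borel) Y {k, l}"
      by (rule indep_vars_subset[OF indep]) (use that in auto)
    moreover have "integrable M (Y i)" if "i \<in> {k, l}" for i
      using that \<open>k \<ge> 1\<close> \<open>l \<ge> 1\<close> int by auto
    ultimately show ?thesis
      using indep_vars_lebesgue_integral[of "{k, l}" Y] indep_vars_integrable[of "{k, l}" Y] that mean
      by simp
  qed
  have prod_int: "integrable M (\<lambda>x. Y k x * Y l x)" if "k \<ge> 1" "l \<ge> 1" for k l
    using prod[OF that] sq[of k] that by (cases "k = l") (auto simp: power2_eq_square)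
  have "AE x in M. (\<lambda>n. (\<Sum>k=1..n. Z k x) / real n) \<longlonglongrightarrow> 0"
  proof (rule strong_law_uncorrelated[where c = "c - \<mu>\<^sup>2"])
    fix k l :: nat assume kl: "k \<ge> 1" "l \<ge> 1"
    note i = prod_int[OF kl] int[OF kl(1)] int[OF kl(2)]
    show "integrable M (\<lambda>x. Z k x * Z l x)" unfolding ZZ using i by auto
    have e: "(\<integral>x. Z k x * Z l x \<partial>M) = expectation (\<lambda>x. Y k x * Y l x) - \<mu>\<^sup>2"
      unfolding ZZ using i kl by (simp add: mean prob_space power2_eq_square)
    show "(\<integral>x. Z k x * Z l x \<partial>M) = 0" if "k \<noteq> l"
      using e prod[OF kl that] by (simp add: power2_eq_square)
    show "(\<integral>x. Z k x * Z k x \<partial>M) \<le> c - \<mu>\<^sup>2"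
      unfolding ZZ using second[OF kl(1)] int[OF kl(1)] prod_int[OF kl(1) kl(1)]
      by (simp add: mean[OF kl(1)] prob_space power2_eq_square)
  qed
  then show ?thesis
  proof eventually_elim
    case (elim x)
    have "(\<lambda>n. (\<Sum>k=1..n. Y k x) / real n - \<mu>) \<longlonglongrightarrow> 0"
    proof (rule Lim_transform_eventually[OF elim])
      \<comment> \<open>Only eventually: at \<open>n = 0\<close> the left side is 0 and the right
        side is \<open>- \<mu>\<close>.\<close>
      show "\<forall>\<^sub>F n in sequentially. (\<Sum>k=1..n. Z k x) / real n = (\<Sum>k=1..n. Y k x) / real n - \<mu>"
        using eventually_gt_at_top[of 0]
        by eventually_elim (simp add: Z_def sum_subtractf diff_divide_distrib)
    qed
    then show ?case by (simp add: LIM_zero_iff)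
  qed
qed

subsection \<open>Moments of the multivariate normal law\<close>

text \<open>The left side is the second difference \<open>exp u + exp (- u) - 2\<close>. After
  division by the squared step, this bound yields the dominating function for the difference
  quotients in \<open>moments_of_gaussian_mgf\<close>.\<close>

lemma square_exp_diff_le:
  fixes u :: real
  shows "(exp (u / 2) - exp (- u / 2))\<^sup>2 \<le> u\<^sup>2 * exp \<bar>u\<bar>"
proof -
  have *: "(exp (x / 2) - exp (- x / 2))\<^sup>2 \<le> x\<^sup>2 * exp x" if "x \<ge> 0" for x :: real
  proof -
    have "exp (x / 2) - exp (- x / 2) = exp (x / 2) * (1 - exp (- x))"
      by (simp add: right_diff_distrib flip: exp_add)
    also have "\<dots> \<le> exp (x / 2) * x"
      using exp_ge_add_one_self[of "- x"] by (intro mult_left_mono) auto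
    finally have "(exp (x / 2) - exp (- x / 2))\<^sup>2 \<le> (exp (x / 2) * x)\<^sup>2"
      using that by (intro power_mono) auto
    also have "\<dots> = x\<^sup>2 * exp x"
      by (simp add: power_mult_distrib mult.commute flip: exp_double)
    finally show ?thesis .
  qed
  show ?thesis
  proof (cases "u \<ge> 0")
    case False
    then show ?thesis using *[of "- u"] by (simp add: power2_commute)
  qed (use * in auto)
qed

lemma square_le_exp_abs: "(x::real)\<^sup>2 \<le> 2 * exp \<bar>x\<bar>"
  using exp_lower_Taylor_quadratic[of "\<bar>x\<bar>"] by simp

lemma exp_abs_le: "exp \<bar>x\<bar> \<le> exp x + exp (- x)" for x :: real
  by (cases "x \<ge> 0") (auto simp: abs_if)

text \<open>The second moment is the second derivative of the moment generating function at 0,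
  obtained by dominated convergence of second difference quotients. Exponential moments of both
  signs make \<open>exp \<bar>s * Z x\<bar>\<close> integrable, which dominates the quotients and
  the fourth power alike.\<close>

lemma moments_of_gaussian_mgf:
  fixes Z :: "'a \<Rightarrow> real"
  assumes Z [measurable]: "Z \<in> borel_measurable M"
    and int: "\<And>s. integrable M (\<lambda>x. exp (s * Z x))"
    and mgf: "\<And>s. (\<integral>x. exp (s * Z x) \<partial>M) = exp (s\<^sup>2 * v / 2)"
  shows "integrable M (\<lambda>x. (Z x)\<^sup>2)" "(\<integral>x. (Z x)\<^sup>2 \<partial>M) = v" "integrable M (\<lambda>x. (Z x) ^ 4)"
proof -
  have int_abs: "integrable M (\<lambda>x. exp \<bar>s * Z x\<bar>)" for s
  proof (rule Bochner_Integration.integrable_bound)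
    show "integrable M (\<lambda>x. exp (s * Z x) + exp (- s * Z x))"
      by (intro Bochner_Integration.integrable_add int)
    show "AE x in M. norm (exp \<bar>s * Z x\<bar>) \<le> norm (exp (s * Z x) + exp (- s * Z x))"
      using exp_abs_le[of "s * Z x" for x] by (simp add: add_nonneg_nonneg)
  qed measurable
  show "integrable M (\<lambda>x. (Z x) ^ 4)"
  proof (rule Bochner_Integration.integrable_bound)
    show "integrable M (\<lambda>x. 64 * exp \<bar>1 * Z x\<bar>)"
      using int_abs[of 1] by simp
    \<comment> \<open>Squaring \<open>square_le_exp_abs\<close> at \<open>z / 2\<close> gives
      \<open>z ^ 4 / 16 \<le> 4 * exp \<bar>z\<bar>\<close>.\<close>
    have "(z::real) ^ 4 \<le> 64 * exp \<bar>z\<bar>" for z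
    proof -
      have "(z / 2)\<^sup>2 * (z / 2)\<^sup>2 \<le> (2 * exp \<bar>z / 2\<bar>) * (2 * exp \<bar>z / 2\<bar>)"
        by (intro mult_mono square_le_exp_abs) auto
      then show ?thesis by (simp add: power2_eq_square eval_nat_numeral flip: exp_add)
    qed
    then show "AE x in M. norm ((Z x) ^ 4) \<le> norm (64 * exp \<bar>1 * Z x\<bar>)"
      by simp
  qed measurable
  define w where "w x = 2 * exp \<bar>2 * Z x\<bar>" for x
  have w: "integrable M w" unfolding w_def[abs_def] using int_abs[of 2] by simp
  define h where "h n = inverse (real (Suc n))" for n
  have h: "h n \<noteq> 0" "\<bar>h n\<bar> \<le> 1" for n by (auto simp: h_def divide_simps)
  have h_lim: "h \<longlonglongrightarrow> 0"
    unfolding h_def[abs_def] by (rule LIMSEQ_inverse_real_of_nat)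
  have h_at: "filterlim h (at 0) sequentially"
    using h_lim h(1) by (simp add: filterlim_at)
  have h2_at: "filterlim (\<lambda>n. (h n)\<^sup>2) (at 0) sequentially"
    using tendsto_power[OF h_lim, of 2] h(1) by (simp add: filterlim_at)
  \<comment> \<open>The second difference quotient of \<open>\<lambda>t. exp (t * Z x)\<close> at 0, written as a square.\<close>
  define g where "g n x = ((exp (h n * Z x / 2) - exp (- (h n * Z x) / 2)) / h n)\<^sup>2" for n x
  have g_lim: "(\<lambda>n. g n x) \<longlonglongrightarrow> (Z x)\<^sup>2" for x
  proof -
    have "((\<lambda>t. exp (t * Z x / 2) - exp (- (t * Z x) / 2)) has_real_derivative Z x) (at 0)"
      by (auto intro!: derivative_eq_intros)
    from filterlim_compose[OF DERIV_D[OF this] h_at]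
    show ?thesis unfolding g_def by (intro tendsto_power) simp
  qed
  have g_bound: "norm (g n x) \<le> w x" for n x
  proof -
    let ?u = "h n * Z x"
    have le: "\<bar>?u\<bar> \<le> \<bar>Z x\<bar>" using h(2)[of n] by (simp add: abs_mult mult_left_le_one_le)
    have "norm (g n x) = (exp (?u / 2) - exp (- ?u / 2))\<^sup>2 / (h n)\<^sup>2"
      by (simp add: g_def power_divide)
    also have "\<dots> \<le> (?u\<^sup>2 * exp \<bar>?u\<bar>) / (h n)\<^sup>2"
      by (intro divide_right_mono square_exp_diff_le) auto
    also have "\<dots> = (Z x)\<^sup>2 * exp \<bar>?u\<bar>" using h(1)[of n] by (simp add: power_mult_distrib)
    also have "\<dots> \<le> (2 * exp \<bar>Z x\<bar>) * exp \<bar>Z x\<bar>"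
      using le by (intro mult_mono square_le_exp_abs) auto
    also have "\<dots> = w x" by (simp add: w_def abs_mult flip: exp_add)
    finally show ?thesis .
  qed
  have g_meas [measurable]: "g n \<in> borel_measurable M" for n unfolding g_def[abs_def] by measurable
  have Z2: "(\<lambda>x. (Z x)\<^sup>2) \<in> borel_measurable M" by measurable
  note dct = Z2 g_meas w AE_I2[OF g_lim] AE_I2[OF g_bound]
  show "integrable M (\<lambda>x. (Z x)\<^sup>2)" by (rule integrable_dominated_convergence[OF dct])
  have lim1: "(\<lambda>n. \<integral>x. g n x \<partial>M) \<longlonglongrightarrow> (\<integral>x. (Z x)\<^sup>2 \<partial>M)"
    by (rule integral_dominated_convergence[OF dct])
  have int_g: "(\<integral>x. g n x \<partial>M) = 2 * ((exp ((h n)\<^sup>2 * v / 2) - 1) / (h n)\<^sup>2)" for n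
  proof -
    \<comment> \<open>The constant 2 is written \<open>2 * exp (0 * Z x)\<close>, so that
      \<open>int\<close> and \<open>mgf\<close> at 0 also account for the total mass 1.\<close>
    have "g n x = (exp (h n * Z x) + exp (- h n * Z x) - 2 * exp (0 * Z x)) / (h n)\<^sup>2" for x
      by (simp add: g_def power_divide power2_diff flip: exp_double exp_add)
    then have "(\<integral>x. g n x \<partial>M)
        = (\<integral>x. (exp (h n * Z x) + exp (- h n * Z x) - 2 * exp (0 * Z x)) / (h n)\<^sup>2 \<partial>M)" by simp
    also have "\<dots> = ((\<integral>x. exp (h n * Z x) \<partial>M) + (\<integral>x. exp (- h n * Z x) \<partial>M)
        - 2 * (\<integral>x. exp (0 * Z x) \<partial>M)) / (h n)\<^sup>2"
    proof -
      have "(\<integral>x. (a x + b x - 2 * k x) / d \<partial>M)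
          = ((\<integral>x. a x \<partial>M) + (\<integral>x. b x \<partial>M) - 2 * (\<integral>x. k x \<partial>M)) / d"
        if "integrable M a" "integrable M b" "integrable M k" for a b k :: "'a \<Rightarrow> real" and d
        using that by simp
      from this[OF int int int] show ?thesis .
    qed
    also have "\<dots> = 2 * ((exp ((h n)\<^sup>2 * v / 2) - 1) / (h n)\<^sup>2)"
      unfolding mgf by (simp add: field_simps)
    finally show ?thesis .
  qed
  \<comment> \<open>In the variable \<open>t = (h n)\<^sup>2\<close>, the right side of
    \<open>int_g\<close> is twice a first-order difference quotient at 0.\<close>
  have "((\<lambda>t. exp (t * v / 2)) has_real_derivative v / 2) (at 0)"
    by (auto intro!: derivative_eq_intros)
  from filterlim_compose[OF DERIV_D[OF this] h2_at]
  have "(\<lambda>n. \<integral>x. g n x \<partial>M) \<longlonglongrightarrow> 2 * (v / 2)"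
    unfolding int_g by (intro tendsto_mult_left) simp
  then show "(\<integral>x. (Z x)\<^sup>2 \<partial>M) = v"
    using LIMSEQ_unique[OF lim1] by simp
qed

lemma lborel_translate:
  fixes f :: "'a::euclidean_space \<Rightarrow> real"
  assumes [measurable]: "f \<in> borel_measurable borel"
  shows "integrable lborel (\<lambda>x. f (c + x)) \<longleftrightarrow> integrable lborel f"
    "(\<integral>x. f (c + x) \<partial>lborel) = (\<integral>x. f x \<partial>lborel)"
  using integrable_distr_eq[of "(+) c" lborel borel f] integral_distr[of "(+) c" lborel borel f]
  by (simp_all add: lborel_distr_plus)

text \<open>Completing the square turns the exponential moment into a translate of the density, so
  that only the total mass 1 and not the normalising constant is needed.\<close>

lemma mvn_exponential_moment:
  fixes Y :: "'w \<Rightarrow> real^'n"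
  assumes P: "prob_space P"
    and D: "distributed P lborel Y (\<lambda>x. ennreal (mvn_density 0 V x))"
    and V: "invertible V" "V \<in> sym_mats"
  shows "integrable P (\<lambda>\<omega>. exp (t \<bullet> Y \<omega>))"
    "(\<integral>\<omega>. exp (t \<bullet> Y \<omega>) \<partial>P) = exp (t \<bullet> (V *v t) / 2)"
proof -
  interpret prob_space P by fact
  let ?f = "mvn_density 0 V"
  let ?A = "matrix_inv V"
  define c where "c = sqrt ((2 * pi) ^ CARD('n) * det V)"
  have f: "?f x = exp (- (x \<bullet> (?A *v x)) / 2) / c" for x
    by (simp add: mvn_density_def c_def)
  have f_meas [measurable]: "?f \<in> borel_measurable borel"
    unfolding f by (intro borel_measurable_divide borel_measurable_continuous_onI continuous_intros) auto
  \<comment> \<open>Positivity comes from \<open>D\<close>: with \<open>c \<le> 0\<close> (including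
    division by zero) the density would be 0 as an \<open>ennreal\<close> everywhere, against total
    mass 1.\<close>
  have "c > 0"
  proof (rule ccontr)
    assume "\<not> c > 0"
    then have "ennreal (?f x) = 0" for x
      by (simp add: f ennreal_eq_0_iff divide_nonneg_nonpos not_less)
    then have "emeasure P (Y -` space lborel \<inter> space P) = 0"
      using distributed_emeasure[OF D, of "space lborel"] by simp
    then show False by (simp add: emeasure_space_1)
  qed
  then have f_nonneg: "0 \<le> ?f x" for x by (simp add: f)
  have one: "integrable lborel ?f" "(\<integral>x. ?f x \<partial>lborel) = 1"
    using distributed_integrable[OF D, of "\<lambda>_. 1::real"] distributed_integral[OF D, of "\<lambda>_. 1::real"]
      f_nonneg by (simp_all add: prob_space)
  have VA: "V *v (?A *v x) = x" "?A *v (V *v x) = x" for x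
    using matrix_inv_mult[OF V(1)] by (simp_all add: matrix_vector_mul_assoc)
  have shift: "?f x * exp (t \<bullet> x) = exp (t \<bullet> (V *v t) / 2) * ?f (- (V *v t) + x)" for x
  proof -
    have cross: "(V *v t) \<bullet> (?A *v x) = t \<bullet> x"
      using self_adjoint_dot[OF V(2), of t "?A *v x"] by (simp add: VA)
    have "- (V *v t) + x = x - V *v t" by simp
    then have "(- (V *v t) + x) \<bullet> (?A *v (- (V *v t) + x)) = x \<bullet> (?A *v x) - 2 * (t \<bullet> x) + t \<bullet> (V *v t)"
      by (simp only: matrix_vector_mult_diff_distrib VA inner_diff_left inner_diff_right cross)
        (simp add: inner_commute)
    then show ?thesis
      by (simp add: f mult_ac flip: exp_add) (simp add: field_simps)
  qed
  have f_shift: "integrable lborel (\<lambda>x. ?f (- (V *v t) + x))" "(\<integral>x. ?f (- (V *v t) + x) \<partial>lborel) = 1"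
    using one by (simp_all only: lborel_translate[OF f_meas])
  have exp_meas: "(\<lambda>x. exp (t \<bullet> x)) \<in> borel_measurable lborel"
    by measurable
  show "integrable P (\<lambda>\<omega>. exp (t \<bullet> Y \<omega>))"
    using distributed_integrable[OF D exp_meas f_nonneg] f_shift(1) by (simp add: shift)
  show "(\<integral>\<omega>. exp (t \<bullet> Y \<omega>) \<partial>P) = exp (t \<bullet> (V *v t) / 2)"
    using distributed_integral[OF D exp_meas f_nonneg] f_shift(2) by (simp add: shift)
qed

text \<open>Each \<open>t \<bullet> Y \<omega>\<close> has a one-dimensional Gaussian moment
  generating function with variance \<open>t \<bullet> (V *v t)\<close>. Fourth moments of
  coordinates bound the squared products.\<close>

lemma mvn_second_moments:
  fixes Y :: "'w \<Rightarrow> real^'n"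
  assumes P: "prob_space P"
    and D: "distributed P lborel Y (\<lambda>x. ennreal (mvn_density 0 V x))"
    and V: "invertible V" "V \<in> sym_mats"
  shows "integrable P (\<lambda>\<omega>. (Y \<omega> $ i * Y \<omega> $ j)\<^sup>2)" "(\<integral>\<omega>. Y \<omega> $ i * Y \<omega> $ j \<partial>P) = V $ i $ j"
proof -
  have Y [measurable]: "Y \<in> borel_measurable P"
    using distributed_measurable[OF D] by simp
  have Yi [measurable]: "(\<lambda>\<omega>. Y \<omega> $ i) \<in> borel_measurable P" for i
    by (rule measurable_compose[OF Y])
      (intro borel_measurable_continuous_onI continuous_intros)
  have mom: "integrable P (\<lambda>\<omega>. (t \<bullet> Y \<omega>)\<^sup>2)" "(\<integral>\<omega>. (t \<bullet> Y \<omega>)\<^sup>2 \<partial>P) = t \<bullet> (V *v t)"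
     "integrable P (\<lambda>\<omega>. (t \<bullet> Y \<omega>) ^ 4)" for t
  proof -
    note e = mvn_exponential_moment[OF P D V, of "s *\<^sub>R t" for s]
    have "integrable P (\<lambda>\<omega>. exp (s * (t \<bullet> Y \<omega>)))"
      "(\<integral>\<omega>. exp (s * (t \<bullet> Y \<omega>)) \<partial>P) = exp (s\<^sup>2 * (t \<bullet> (V *v t)) / 2)" for s
      using e[of s] by (simp_all add: matrix_vector_mult_scaleR power2_eq_square)
    from moments_of_gaussian_mgf[OF _ this] 
    show "integrable P (\<lambda>\<omega>. (t \<bullet> Y \<omega>)\<^sup>2)" "(\<integral>\<omega>. (t \<bullet> Y \<omega>)\<^sup>2 \<partial>P) = t \<bullet> (V *v t)"
     "integrable P (\<lambda>\<omega>. (t \<bullet> Y \<omega>) ^ 4)" by auto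
  qed
  have dot: "axis k 1 \<bullet> y = y $ k" for k and y :: "real^'n"
    by (simp add: inner_axis')
  have Vk: "(V *v axis k 1) $ l = V $ l $ k" for k l
    by (simp add: matrix_vector_mul_component inner_axis)
  show "integrable P (\<lambda>\<omega>. (Y \<omega> $ i * Y \<omega> $ j)\<^sup>2)"
  proof (rule Bochner_Integration.integrable_bound)
    show "integrable P (\<lambda>\<omega>. (Y \<omega> $ i) ^ 4 + (Y \<omega> $ j) ^ 4)"
      using mom(3)[of "axis i 1"] mom(3)[of "axis j 1"] by (simp add: dot)
    have "(a * b)\<^sup>2 \<le> a ^ 4 + b ^ 4" for a b :: real
    proof -
      have "2 * (a\<^sup>2 * b\<^sup>2) \<le> (a\<^sup>2)\<^sup>2 + (b\<^sup>2)\<^sup>2"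
        using sum_squares_bound[of "a\<^sup>2" "b\<^sup>2"] by (simp add: mult_ac)
      moreover have "0 \<le> a\<^sup>2 * b\<^sup>2" by simp
      ultimately have "a\<^sup>2 * b\<^sup>2 \<le> (a\<^sup>2)\<^sup>2 + (b\<^sup>2)\<^sup>2" by linarith
      then show ?thesis by (simp add: power_mult_distrib)
    qed
    then show "AE \<omega> in P. norm ((Y \<omega> $ i * Y \<omega> $ j)\<^sup>2) \<le> norm ((Y \<omega> $ i) ^ 4 + (Y \<omega> $ j) ^ 4)"
      by simp
  qed measurable
  have Vsym: "V $ j $ i = V $ i $ j"
    using V(2) by (auto simp: sym_mats_def transpose_def vec_eq_iff)
  \<comment> \<open>Polarisation recovers the mixed moment from the quadratic form at three
    vectors.\<close>
  have "(\<integral>\<omega>. Y \<omega> $ i * Y \<omega> $ j \<partial>P)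
      = (\<integral>\<omega>. (((axis i 1 + axis j 1) \<bullet> Y \<omega>)\<^sup>2 - (axis i 1 \<bullet> Y \<omega>)\<^sup>2 - (axis j 1 \<bullet> Y \<omega>)\<^sup>2) / 2 \<partial>P)"
    by (simp add: inner_add_left dot power2_sum)
  also have "\<dots> = ((axis i 1 + axis j 1) \<bullet> (V *v (axis i 1 + axis j 1))
      - axis i 1 \<bullet> (V *v axis i 1) - axis j 1 \<bullet> (V *v axis j 1)) / 2"
    using mom(1) by (simp add: mom(2))
  also have "\<dots> = V $ i $ j"
    by (simp add: matrix_vector_right_distrib inner_add_left inner_add_right dot Vk Vsym)
  finally show "(\<integral>\<omega>. Y \<omega> $ i * Y \<omega> $ j \<partial>P) = V $ i $ j" .
qed

section \<open>Algebra of the Kronecker product\<close>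

lemma sum_UNIV_pair: "(\<Sum>k\<in>UNIV. f (fst k) (snd k)) = (\<Sum>a\<in>UNIV. \<Sum>b\<in>UNIV. f a b)"
  for f :: "'a::finite \<Rightarrow> 'b::finite \<Rightarrow> real"
  by (simp add: sum.cartesian_product case_prod_unfold)

lemma kron_mult: "kron A B ** kron C D = kron (A ** C) (B ** D)"
proof -
  have "(\<Sum>k\<in>UNIV. A $ a $ fst k * B $ b $ snd k * (C $ fst k $ c * D $ snd k $ d))
    = (\<Sum>k\<in>UNIV. A $ a $ k * C $ k $ c) * (\<Sum>k\<in>UNIV. B $ b $ k * D $ k $ d)" for a b c d
    using sum_UNIV_pair[of "\<lambda>x y. A $ a $ x * B $ b $ y * (C $ x $ c * D $ y $ d)"]
    by (simp add: sum_product mult_ac)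
  then show ?thesis
    by (simp add: kron_def matrix_matrix_mult_def vec_eq_iff)
qed

lemma kron_mat_1: "kron (mat 1) (mat 1) = mat 1"
  by (auto simp: kron_def mat_def vec_eq_iff prod_eq_iff)

lemma invertible_kron:
  assumes "invertible A" "invertible B"
  shows "invertible (kron A B)"
  using assms unfolding invertible_def by (metis kron_mult kron_mat_1)

lemma kron_sym:
  assumes "A \<in> sym_mats" "B \<in> sym_mats"
  shows "kron A B \<in> sym_mats"
  using assms by (simp add: sym_mats_def kron_def transpose_def vec_eq_iff)

subsection \<open>Convergence of the Stein moments\<close>

lemma stack_columns_transpose_nth [simp]: "stack_columns (transpose A) $ (a, i) = A $ a $ i"
  by (simp add: stack_columns_def transpose_def)

text \<open>The right side of the third claim mentions neither \<open>P\<close> nor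
  \<open>X\<close>; it serves as the bound, common to all observations, that the strong law
  requires.\<close>

lemma matrix_normal_entry_moments:
  fixes X :: "'w \<Rightarrow> real^'d^'v"
  assumes P: "prob_space P" and X: "matrix_normal P X 0 \<Psi> S"
    and pd: "S \<in> pd_mats" "\<Psi> \<in> pd_mats"
  shows "integrable P (\<lambda>\<omega>. (X \<omega> $ a $ i * X \<omega> $ b $ j)\<^sup>2)"
    "(\<integral>\<omega>. X \<omega> $ a $ i * X \<omega> $ b $ j \<partial>P) = \<Psi> $ a $ b * S $ i $ j"
    "(\<integral>\<omega>. (X \<omega> $ a $ i * X \<omega> $ b $ j)\<^sup>2 \<partial>P)
      = (\<integral>x. (x $ (a, i) * x $ (b, j))\<^sup>2 \<partial>density lborel (\<lambda>x. ennreal (mvn_density 0 (kron \<Psi> S) x)))"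
proof -
  let ?Y = "\<lambda>\<omega>. stack_columns (transpose (X \<omega>))"
  have zero: "stack_columns (transpose 0) = 0"
    by (simp add: stack_columns_def transpose_def vec_eq_iff)
  have D: "distributed P lborel ?Y (\<lambda>x. ennreal (mvn_density 0 (kron \<Psi> S) x))"
    using X by (simp add: matrix_normal_def zero)
  have V: "invertible (kron \<Psi> S)" "kron \<Psi> S \<in> sym_mats"
    using pd pd[unfolded pd_mats_def] by (blast intro: invertible_kron pd_mats_invertible kron_sym)+
  note m = mvn_second_moments[OF P D V, of "(a, i)" "(b, j)"]
  show "integrable P (\<lambda>\<omega>. (X \<omega> $ a $ i * X \<omega> $ b $ j)\<^sup>2)" using m(1) by simp
  show "(\<integral>\<omega>. X \<omega> $ a $ i * X \<omega> $ b $ j \<partial>P) = \<Psi> $ a $ b * S $ i $ j"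
    using m(2) by (simp add: kron_def)
  have "(\<lambda>x :: real^('v \<times> 'd). (x $ (a, i) * x $ (b, j))\<^sup>2) \<in> borel_measurable lborel"
    by (subst measurable_cong_sets[OF sets_lborel refl])
      (intro borel_measurable_continuous_onI continuous_intros)
  from integral_distr[OF distributed_measurable[OF D] this]
  show "(\<integral>\<omega>. (X \<omega> $ a $ i * X \<omega> $ b $ j)\<^sup>2 \<partial>P)
      = (\<integral>x. (x $ (a, i) * x $ (b, j))\<^sup>2 \<partial>density lborel (\<lambda>x. ennreal (mvn_density 0 (kron \<Psi> S) x)))"
    by (simp add: distributed_distr_eq_density[OF D])
qed

lemma matrix_normal_entry_averages:
  fixes X :: "nat \<Rightarrow> 'w \<Rightarrow> real^'d^'v"
  assumes P: "prob_space P" and indep: "prob_space.indep_vars P (\<lambda>_. borel) X {1..}"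
    and X: "\<And>k. k \<ge> 1 \<Longrightarrow> matrix_normal P (X k) 0 \<Psi> S"
    and pd: "S \<in> pd_mats" "\<Psi> \<in> pd_mats"
  shows "AE \<omega> in P. \<forall>a b i j.
    (\<lambda>n. (\<Sum>k=1..n. X k \<omega> $ a $ i * X k \<omega> $ b $ j) / real n) \<longlonglongrightarrow> \<Psi> $ a $ b * S $ i $ j"
proof -
  interpret prob_space P by fact
  have "AE \<omega> in P. (\<lambda>n. (\<Sum>k=1..n. X k \<omega> $ a $ i * X k \<omega> $ b $ j) / real n) \<longlonglongrightarrow> \<Psi> $ a $ b * S $ i $ j"
    for a b i j
  proof (rule strong_law_square_integrable)
    have "(\<lambda>x :: real^'d^'v. x $ a $ i * x $ b $ j) \<in> borel_measurable borel"
      by (intro borel_measurable_continuous_onI continuous_intros)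
    then show "indep_vars (\<lambda>_. borel) (\<lambda>k \<omega>. X k \<omega> $ a $ i * X k \<omega> $ b $ j) {1..}"
      by (rule indep_vars_compose2[OF indep])
  next
    fix k :: nat assume k: "k \<ge> 1"
    note m = matrix_normal_entry_moments[OF P X[OF k] pd, of a i b j]
    show "integrable P (\<lambda>\<omega>. (X k \<omega> $ a $ i * X k \<omega> $ b $ j)\<^sup>2)" by (fact m(1))
    show "(\<integral>\<omega>. X k \<omega> $ a $ i * X k \<omega> $ b $ j \<partial>P) = \<Psi> $ a $ b * S $ i $ j" by (fact m(2))
    show "(\<integral>\<omega>. (X k \<omega> $ a $ i * X k \<omega> $ b $ j)\<^sup>2 \<partial>P) \<le>
      (\<integral>x. (x $ (a, i) * x $ (b, j))\<^sup>2 \<partial>density lborel (\<lambda>x. ennreal (mvn_density 0 (kron \<Psi> S) x)))"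
      by (rule eq_refl[OF m(3)])
  qed
  \<comment> \<open>There are finitely many index quadruples, so one null set serves them
    all.\<close>
  then show ?thesis by (simp add: AE_all_countable)
qed

lemma trace_bilinear_entries:
  fixes X :: "real^'d^'v"
  shows "trace (transpose X ** G ** X ** H) =
    (\<Sum>a\<in>UNIV. \<Sum>b\<in>UNIV. \<Sum>i\<in>UNIV. \<Sum>j\<in>UNIV. G $ a $ b * H $ j $ i * (X $ a $ i * X $ b $ j))"
proof -
  have "trace (transpose X ** G ** X ** H) =
    (\<Sum>i\<in>UNIV. \<Sum>j\<in>UNIV. \<Sum>b\<in>UNIV. \<Sum>a\<in>UNIV. G $ a $ b * H $ j $ i * (X $ a $ i * X $ b $ j))"
    by (simp add: trace_def matrix_matrix_mult_def transpose_def sum_distrib_right sum_distrib_left mult_ac)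
  also have "\<dots> = (\<Sum>(i, j, b, a)\<in>UNIV. G $ a $ b * H $ j $ i * (X $ a $ i * X $ b $ j))"
    by (simp add: sum.cartesian_product case_prod_unfold)
  also have "\<dots> = (\<Sum>(a, b, i, j)\<in>UNIV. G $ a $ b * H $ j $ i * (X $ a $ i * X $ b $ j))"
    by (rule sum.reindex_bij_witness[of _ "\<lambda>(a, b, i, j). (i, j, b, a)" "\<lambda>(i, j, b, a). (a, b, i, j)"]) auto
  also have "\<dots> = (\<Sum>a\<in>UNIV. \<Sum>b\<in>UNIV. \<Sum>i\<in>UNIV. \<Sum>j\<in>UNIV. G $ a $ b * H $ j $ i * (X $ a $ i * X $ b $ j))"
    by (simp add: sum.cartesian_product case_prod_unfold)
  finally show ?thesis .
qed

text \<open>Both moment vectors are instances: whitening sits in \<open>G\<close> for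
  \<open>y_Sigma\<close> and in \<open>H\<close> for \<open>y_Psi\<close>. The quadruple sum splits
  because the limits of the entry averages factorise.\<close>

lemma trace_bilinear_averages:
  fixes x :: "nat \<Rightarrow> real^'d^'v"
  assumes lim: "\<And>a b i j. (\<lambda>n. (\<Sum>k=1..n. x k $ a $ i * x k $ b $ j) / real n) \<longlonglongrightarrow> \<Psi> $ a $ b * S $ i $ j"
    and sym: "\<Psi> \<in> sym_mats"
  shows "(\<lambda>n. (\<Sum>k=1..n. trace (transpose (x k) ** G ** x k ** H)) / real n) \<longlonglongrightarrow> trace (G ** \<Psi>) * trace (S ** H)"
proof -
  have swap: "(\<Sum>k=1..n. trace (transpose (x k) ** G ** x k ** H)) / real n =
    (\<Sum>a\<in>UNIV. \<Sum>b\<in>UNIV. \<Sum>i\<in>UNIV. \<Sum>j\<in>UNIV. G $ a $ b * H $ j $ i * ((\<Sum>k=1..n. x k $ a $ i * x k $ b $ j) / real n))" for n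
    unfolding trace_bilinear_entries
    by (simp add: sum_distrib_left sum_divide_distrib sum.swap[of _ "{1..n}"] del: One_nat_def)
  \<comment> \<open>Transposing the indices of \<open>\<Psi>\<close> produces the pattern of
    \<open>trace (G ** \<Psi>)\<close>.\<close>
  have sym': "\<Psi> $ a $ b = \<Psi> $ b $ a" for a b
    using sym by (auto simp: sym_mats_def transpose_def vec_eq_iff)
  have "(\<Sum>a\<in>UNIV. \<Sum>b\<in>UNIV. \<Sum>i\<in>UNIV. \<Sum>j\<in>UNIV. G $ a $ b * H $ j $ i * (\<Psi> $ a $ b * S $ i $ j))
    = (\<Sum>a\<in>UNIV. \<Sum>b\<in>UNIV. \<Sum>i\<in>UNIV. \<Sum>j\<in>UNIV. (G $ a $ b * \<Psi> $ b $ a) * (S $ i $ j * H $ j $ i))"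
    by (intro sum.cong refl) (simp add: sym' mult_ac)
  also have "\<dots> = (\<Sum>a\<in>UNIV. \<Sum>b\<in>UNIV. G $ a $ b * \<Psi> $ b $ a) * (\<Sum>i\<in>UNIV. \<Sum>j\<in>UNIV. S $ i $ j * H $ j $ i)"
    by (simp only: sum_distrib_left[symmetric] sum_distrib_right[symmetric])
  also have "\<dots> = trace (G ** \<Psi>) * trace (S ** H)"
    by (simp add: trace_def matrix_matrix_mult_def)
  finally have eq: "(\<Sum>a\<in>UNIV. \<Sum>b\<in>UNIV. \<Sum>i\<in>UNIV. \<Sum>j\<in>UNIV. G $ a $ b * H $ j $ i * (\<Psi> $ a $ b * S $ i $ j))
    = trace (G ** \<Psi>) * trace (S ** H)" .
  show ?thesis
    unfolding swap eq[symmetric] by (intro tendsto_intros lim)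
qed

lemma trace_whitened:
  assumes "S \<in> pd_mats"
  shows "trace (inv_sqrt S ** W ** inv_sqrt S ** S) = trace W"
    "trace (S ** (inv_sqrt S ** W ** inv_sqrt S)) = trace W"
proof -
  have "trace (inv_sqrt S ** W ** inv_sqrt S ** S) = trace (W ** (inv_sqrt S ** S ** inv_sqrt S))"
    by (metis trace_mul_sym matrix_mul_assoc)
  then show "trace (inv_sqrt S ** W ** inv_sqrt S ** S) = trace W"
    by (simp add: inv_sqrt_whitens[OF assms])
  then show "trace (S ** (inv_sqrt S ** W ** inv_sqrt S)) = trace W"
    by (simp add: trace_mul_sym[of S])
qed

lemma trace_scaled_sum_mult:
  "trace ((c *\<^sub>R (\<Sum>k\<in>I. A k)) ** (U :: real^'n^'n)) = c * (\<Sum>k\<in>I. trace (A k ** U))"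
  by (simp add: scaleR_sum_right trace_mult_sum_left sum_distrib_left)

lemma y_Sigma_tendsto:
  fixes X :: "nat \<Rightarrow> 'w \<Rightarrow> real^'d^'v" and W :: "'r::finite \<Rightarrow> real^'v^'v"
  assumes lim: "\<And>a b i j. (\<lambda>n. (\<Sum>k=1..n. X k \<omega> $ a $ i * X k \<omega> $ b $ j) / real n) \<longlonglongrightarrow> \<Psi> $ a $ b * S $ i $ j"
    and pd: "\<Psi> \<in> pd_mats" and tr: "\<And>r. trace (W r) \<noteq> 0"
  shows "(\<lambda>n. y_Sigma X \<Psi> W U n \<omega>) \<longlonglongrightarrow> (\<chi> m. trace (S ** U m))"
proof (rule vec_tendstoI)
  fix m
  have sym: "\<Psi> \<in> sym_mats" using pd by (simp add: pd_mats_def)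
  let ?Q = "inv_sqrt \<Psi>"
  have "(\<lambda>n. trace (row_moment X \<Psi> (W r) n \<omega> ** U m)) \<longlonglongrightarrow> trace (S ** U m)" for r
  proof -
    have eq: "trace (row_moment X \<Psi> (W r) n \<omega> ** U m) = 1 / trace (W r) *
      ((\<Sum>k=1..n. trace (transpose (X k \<omega>) ** (?Q ** W r ** ?Q) ** X k \<omega> ** U m)) / real n)" for n
      unfolding row_moment_def trace_scaled_sum_mult by (simp add: matrix_mul_assoc mult.commute)
    have "(\<lambda>n. trace (row_moment X \<Psi> (W r) n \<omega> ** U m))
        \<longlonglongrightarrow> 1 / trace (W r) * (trace (?Q ** W r ** ?Q ** \<Psi>) * trace (S ** U m))"
      unfolding eq by (intro tendsto_mult_left trace_bilinear_averages lim sym)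
    then show ?thesis using tr[of r] by (simp add: trace_whitened[OF pd])
  qed
  \<comment> \<open>Every \<open>r\<close> gives the same limit, so the average over
    \<open>r\<close> keeps it.\<close>
  then have "(\<lambda>n. 1 / real CARD('r) * (\<Sum>r\<in>UNIV. trace (row_moment X \<Psi> (W r) n \<omega> ** U m)))
      \<longlonglongrightarrow> 1 / real CARD('r) * (\<Sum>r\<in>(UNIV::'r set). trace (S ** U m))"
    by (intro tendsto_mult_left tendsto_sum) auto
  then show "(\<lambda>n. y_Sigma X \<Psi> W U n \<omega> $ m) \<longlonglongrightarrow> (\<chi> m. trace (S ** U m)) $ m"
    by (simp add: y_Sigma_def)
qed

lemma y_Psi_tendsto:
  fixes X :: "nat \<Rightarrow> 'w \<Rightarrow> real^'d^'v" and U :: "'m::finite \<Rightarrow> real^'d^'d"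
  assumes lim: "\<And>a b i j. (\<lambda>n. (\<Sum>k=1..n. X k \<omega> $ a $ i * X k \<omega> $ b $ j) / real n) \<longlonglongrightarrow> \<Psi> $ a $ b * S $ i $ j"
    and sym: "\<Psi> \<in> sym_mats" and pd: "S \<in> pd_mats" and tr: "\<And>m. trace (U m) \<noteq> 0"
  shows "(\<lambda>n. y_Psi X S W U n \<omega>) \<longlonglongrightarrow> (\<chi> r. trace (\<Psi> ** W r))"
proof (rule vec_tendstoI)
  fix r
  let ?Q = "inv_sqrt S"
  have "(\<lambda>n. trace (col_moment X S (U m) n \<omega> ** W r)) \<longlonglongrightarrow> trace (\<Psi> ** W r)" for m
  proof -
    \<comment> \<open>A cyclic shift under the trace gives the same bilinear form as for the rows,
      with \<open>W r\<close> now between the sample matrices.\<close>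
    have "trace (X k \<omega> ** ?Q ** U m ** ?Q ** transpose (X k \<omega>) ** W r)
        = trace (transpose (X k \<omega>) ** W r ** X k \<omega> ** (?Q ** U m ** ?Q))" for k
      by (metis trace_mul_sym matrix_mul_assoc)
    then have eq: "trace (col_moment X S (U m) n \<omega> ** W r) = 1 / trace (U m) *
      ((\<Sum>k=1..n. trace (transpose (X k \<omega>) ** W r ** X k \<omega> ** (?Q ** U m ** ?Q))) / real n)" for n
      unfolding col_moment_def trace_scaled_sum_mult by simp
    have "(\<lambda>n. trace (col_moment X S (U m) n \<omega> ** W r))
        \<longlonglongrightarrow> 1 / trace (U m) * (trace (W r ** \<Psi>) * trace (S ** (?Q ** U m ** ?Q)))"
      unfolding eq by (intro tendsto_mult_left trace_bilinear_averages lim sym)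
    then show ?thesis using tr[of m] by (simp add: trace_whitened[OF pd] trace_mul_sym[of \<Psi>])
  qed
  then have "(\<lambda>n. 1 / real CARD('m) * (\<Sum>m\<in>UNIV. trace (col_moment X S (U m) n \<omega> ** W r)))
      \<longlonglongrightarrow> 1 / real CARD('m) * (\<Sum>m\<in>(UNIV::'m set). trace (\<Psi> ** W r))"
    by (intro tendsto_mult_left tendsto_sum) auto
  then show "(\<lambda>n. y_Psi X S W U n \<omega> $ r) \<longlonglongrightarrow> (\<chi> r. trace (\<Psi> ** W r)) $ r"
    by (simp add: y_Psi_def)
qed

lemma moment_residual_arg_min:
  assumes "inj ((*v) (design_matrix B U))"
  shows "is_arg_min (moment_residual U y) (\<lambda>T. T \<in> range (structured B))
    (structured B (least_squares (design_matrix B U) y))"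
  using arg_min_least_squares_unique[OF assms, of y "least_squares (design_matrix B U) y"]
  by (auto simp: is_arg_min_linorder moment_residual_structured)

text \<open>Since \<open>arg_min\<close> returns a value even where no minimiser exists, the first
  conjunct certifies that \<open>beta_hat\<close> and \<open>alpha_hat\<close> are the unique
  minimisers. The last one renders the least-squares sense as minimal residual among structured
  matrices.\<close>

theorem proposition5:
  fixes P :: "'w measure"
    and X :: "nat \<Rightarrow> 'w \<Rightarrow> real^'d^'v"
    and S :: "real^'d^'d" and \<Psi> :: "real^'v^'v"
    and B :: "'p::finite \<Rightarrow> real^'d^'d" and A :: "'q::finite \<Rightarrow> real^'v^'v"
    and \<beta> :: "real^'p" and \<alpha> :: "real^'q"
    and W :: "'r::finite \<Rightarrow> real^'v^'v" and U :: "'m::finite \<Rightarrow> real^'d^'d"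
  assumes "prob_space P"
    and "S \<in> pd_mats" and "\<Psi> \<in> pd_mats"
    and "prob_space.indep_vars P (\<lambda>_. borel) X {1..}"
    and "\<And>k. k \<ge> 1 \<Longrightarrow> matrix_normal P (X k) 0 \<Psi> S"
    and "range B \<subseteq> sym_mats" and "range A \<subseteq> sym_mats"
    and "S = structured B \<beta>" and "\<Psi> = structured A \<alpha>"
    and "range W \<subseteq> sym_mats" and "range U \<subseteq> sym_mats"
    and "\<And>r. trace (W r) \<noteq> 0" and "\<And>m. trace (U m) \<noteq> 0"
    and "rank (design_matrix B U) = CARD('p)"
    and "rank (design_matrix A W) = CARD('q)"
  shows
    "(\<forall>n\<ge>1. \<forall>\<omega>\<in>space P.
        (\<forall>b. is_arg_min (lsq_objective (design_matrix B U) (y_Sigma X \<Psi> W U n \<omega>)) (\<lambda>_. True) b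
               \<longleftrightarrow> b = beta_hat X \<Psi> B W U n \<omega>) \<and>
        (\<forall>a. is_arg_min (lsq_objective (design_matrix A W) (y_Psi X S W U n \<omega>)) (\<lambda>_. True) a
               \<longleftrightarrow> a = alpha_hat X S A W U n \<omega>))
     \<and> (AE \<omega> in P. (\<lambda>n. beta_hat X \<Psi> B W U n \<omega>) \<longlonglongrightarrow> \<beta>)
     \<and> (AE \<omega> in P. (\<lambda>n. alpha_hat X S A W U n \<omega>) \<longlonglongrightarrow> \<alpha>)
     \<and> (AE \<omega> in P. (\<lambda>n. structured B (beta_hat X \<Psi> B W U n \<omega>)) \<longlonglongrightarrow> S)
     \<and> (AE \<omega> in P. (\<lambda>n. structured A (alpha_hat X S A W U n \<omega>)) \<longlonglongrightarrow> \<Psi>)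
     \<and> (\<forall>n\<ge>1. \<forall>\<omega>\<in>space P.
        is_arg_min (moment_residual U (y_Sigma X \<Psi> W U n \<omega>)) (\<lambda>T. T \<in> range (structured B))
          (structured B (beta_hat X \<Psi> B W U n \<omega>)) \<and>
        is_arg_min (moment_residual W (y_Psi X S W U n \<omega>)) (\<lambda>T. T \<in> range (structured A))
          (structured A (alpha_hat X S A W U n \<omega>)))"
proof -
  have inj: "inj ((*v) (design_matrix B U))" "inj ((*v) (design_matrix A W))"
    using assms(14,15) by (simp_all add: full_rank_injective)
  have \<Psi>_sym: "\<Psi> \<in> sym_mats" using assms(3) by (simp add: pd_mats_def)
  have target: "design_matrix B U *v \<beta> = (\<chi> m. trace (S ** U m))"
    "design_matrix A W *v \<alpha> = (\<chi> r. trace (\<Psi> ** W r))"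
    unfolding vec_eq_iff design_matrix_mult by (simp_all flip: assms(8,9))
  have "AE \<omega> in P. \<forall>a b i j.
    (\<lambda>n. (\<Sum>k=1..n. X k \<omega> $ a $ i * X k \<omega> $ b $ j) / real n) \<longlonglongrightarrow> \<Psi> $ a $ b * S $ i $ j"
    by (rule matrix_normal_entry_averages[OF assms(1,4) _ assms(2,3)]) (rule assms(5))
  then have lim: "AE \<omega> in P. (\<lambda>n. beta_hat X \<Psi> B W U n \<omega>) \<longlonglongrightarrow> \<beta> \<and> (\<lambda>n. alpha_hat X S A W U n \<omega>) \<longlonglongrightarrow> \<alpha>"
  proof eventually_elim
    case (elim \<omega>)
    have "(\<lambda>n. y_Sigma X \<Psi> W U n \<omega>) \<longlonglongrightarrow> design_matrix B U *v \<beta>"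
      unfolding target by (rule y_Sigma_tendsto[OF _ assms(3,12)]) (use elim in blast)
    moreover have "(\<lambda>n. y_Psi X S W U n \<omega>) \<longlonglongrightarrow> design_matrix A W *v \<alpha>"
      unfolding target by (rule y_Psi_tendsto[OF _ \<Psi>_sym assms(2,13)]) (use elim in blast)
    ultimately show ?case
      unfolding beta_hat_def alpha_hat_def by (intro conjI least_squares_consistent inj)
  qed
  have "AE \<omega> in P. (\<lambda>n. structured B (beta_hat X \<Psi> B W U n \<omega>)) \<longlonglongrightarrow> S"
    using lim unfolding assms(8) by eventually_elim (auto intro: structured_tendsto)
  moreover have "AE \<omega> in P. (\<lambda>n. structured A (alpha_hat X S A W U n \<omega>)) \<longlonglongrightarrow> \<Psi>"
    using lim unfolding assms(9) by eventually_elim (auto intro: structured_tendsto)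
  ultimately show ?thesis
    using lim by (simp add: beta_hat_def alpha_hat_def arg_min_least_squares_unique inj moment_residual_arg_min)
qed

end
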